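(* For any $k\le n$, take any sequences $$n_1,\ldots,n_k\in\mathbb{N},\quad n_1+\cdots+n_k=n,$$ $$1<\lambda_1<\cdots<\lambda_k<2,\quad \lambda_1^{n_1}\cdots\lambda_k^{n_k}=2,$$ and partitions $\boldsymbol\pi^i$ of $n_i$, $i=1,\ldots,k$, i.e. $$\boldsymbol\pi^i=(\pi^i_1\ge\cdots\ge\pi^i_{m_i})\in\mathbb{N}^{m_i},\quad \pi^i_1+\cdots+\pi^i_{m_i}=n_i.$$ For such parameters let $A(\lambda_1,\ldots,\lambda_k;\boldsymbol\pi^1,\ldots,\boldsymbol\pi^k)$ be the corresponding $n\times n$ block diagonal matrix consisting of Jordan blocks for the eigenvalues $\lambda_i$, $i=1,\ldots,k$, of sizes $\pi^i_j$, $j=1,\ldots,m_i$. Then any expansive dilation $A$ in $\mathbb{R}^n$ is equivalent up to a linear transformation to some dilation $A(\lambda_1,\ldots,\lambda_k;\boldsymbol\pi^1,\ldots,\boldsymbol\pi^k)$ of this form. Moreover, this correspondence is one-to-one: dilations of this form for distinct choices of eigenvalues $\lambda_1,\ldots,\lambda_k$ and partitions $\boldsymbol\pi^1,\ldots,\boldsymbol\pi^k$ are not equivalent up to linear transformations.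
   Context: An (expansive) dilation is a real $n\times n$ matrix $A$ all of whose complex eigenvalues satisfy $|\lambda|>1$. A quasi-norm associated with $A$ is a measurable map $\rho_A:\mathbb{R}^n\to[0,\infty)$ such that $\rho_A(x)=0$ iff $x=0$; $\rho_A(Ax)=|\det A|\,\rho_A(x)$ for all $x$; and $\rho_A(x+y)\le c(\rho_A(x)+\rho_A(y))$ for all $x,y$ and some constant $c>0$. Such quasi-norms exist, and any two associated with the same $A$ are comparable up to multiplicative constants. Two dilations $A_1,A_2$ with associated quasi-norms $\rho_1,\rho_2$ are equivalent up to a linear transformation if there are $c>0$ and an invertible real $n\times n$ matrix $S$ with $\frac1c\rho_1(x)\le\rho_2(Sx)\le c\rho_1(x)$ for all $x\in\mathbb{R}^n$. $\mathbb{N}=\{1,2,\ldots\}$.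
   Formalization: The case n = 1 is excluded (n ≥ 2 is assumed): for n = 1 the conditions force λ_1 = 2, contradicting λ_1 < 2, so no parameters exist although expansive dilations of R do, and the first claim fails. *)

theory Defs
  imports "HOL-Analysis.Analysis" "Jordan_Normal_Form.Jordan_Normal_Form"
begin

(* Jordan_Normal_Form has its own det; for matrices of type real^'n^'n the one
   of HOL-Analysis is meant, hence the qualified name Determinants.det. *)

definition complex_eigenvalue :: "real^'n^'n \<Rightarrow> complex \<Rightarrow> bool" where
  "complex_eigenvalue A \<mu> \<longleftrightarrow>
     (\<exists>v :: complex^'n. v \<noteq> 0 \<and> map_matrix complex_of_real A *v v = \<mu> *s v)"

definition expansive_dilation :: "real^'n^'n \<Rightarrow> bool" where
  "expansive_dilation A \<longleftrightarrow> (\<forall>\<mu>. complex_eigenvalue A \<mu> \<longrightarrow> 1 < cmod \<mu>)"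

(* "Measurable" is read as Lebesgue measurable. *)
definition quasi_norm :: "real^'n^'n \<Rightarrow> (real^'n \<Rightarrow> real) \<Rightarrow> bool" where
  "quasi_norm A \<rho> \<longleftrightarrow>
     \<rho> \<in> borel_measurable lebesgue \<and>
     (\<forall>x. 0 \<le> \<rho> x) \<and>
     (\<forall>x. \<rho> x = 0 \<longleftrightarrow> x = 0) \<and>
     (\<forall>x. \<rho> (A *v x) = \<bar>Determinants.det A\<bar> * \<rho> x) \<and>
     (\<exists>c>0. \<forall>x y. \<rho> (x + y) \<le> c * (\<rho> x + \<rho> y))"

(* Any two quasi-norms associated with the same dilation are comparable, so the choice of
   \<rho>\<^sub>1 and \<rho>\<^sub>2 is immaterial. *)
definition linearly_equivalent :: "real^'n^'n \<Rightarrow> real^'n^'n \<Rightarrow> bool" where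
  "linearly_equivalent A\<^sub>1 A\<^sub>2 \<longleftrightarrow>
     (\<exists>\<rho>\<^sub>1 \<rho>\<^sub>2. quasi_norm A\<^sub>1 \<rho>\<^sub>1 \<and> quasi_norm A\<^sub>2 \<rho>\<^sub>2 \<and>
       (\<exists>c>0. \<exists>S :: real^'n^'n. invertible S \<and>
          (\<forall>x. (1 / c) * \<rho>\<^sub>1 x \<le> \<rho>\<^sub>2 (S *v x) \<and> \<rho>\<^sub>2 (S *v x) \<le> c * \<rho>\<^sub>1 x)))"

definition partition_of :: "nat \<Rightarrow> nat list \<Rightarrow> bool" where
  "partition_of m p \<longleftrightarrow> sorted_wrt (\<ge>) p \<and> (\<forall>s\<in>set p. 1 \<le> s) \<and> sum_list p = m"

(* The entries ns ! i, ls ! i, ps ! i with i < k are the multiplicity, the eigenvalue and the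
   partition with index i + 1. *)
definition jordan_parameters ::
  "nat \<Rightarrow> nat \<Rightarrow> nat list \<Rightarrow> real list \<Rightarrow> nat list list \<Rightarrow> bool" where
  "jordan_parameters n k ns ls ps \<longleftrightarrow>
     k \<le> n \<and> length ns = k \<and> length ls = k \<and> length ps = k \<and>
     (\<forall>i<k. 1 \<le> ns ! i) \<and> (\<Sum>i<k. ns ! i) = n \<and>
     (\<forall>i<k. 1 < ls ! i \<and> ls ! i < 2) \<and> sorted_wrt (<) ls \<and>
     (\<Prod>i<k. (ls ! i) ^ (ns ! i)) = 2 \<and>
     (\<forall>i<k. partition_of (ns ! i) (ps ! i))"

definition jordan_blocks :: "real list \<Rightarrow> nat list list \<Rightarrow> (nat \<times> real) list" where
  "jordan_blocks ls ps = concat (map2 (\<lambda>l p. map (\<lambda>s. (s, l)) p) ls ps)"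

(* e numbers the coordinates of real^'n by 0, ..., CARD('n) - 1, which fixes the order of the
   rows and columns of a matrix of type real^'n^'n. *)
definition jordan_dilation :: "('n \<Rightarrow> nat) \<Rightarrow> real list \<Rightarrow> nat list list \<Rightarrow> real^'n^'n" where
  "jordan_dilation e ls ps = (\<chi> i j. jordan_matrix (jordan_blocks ls ps) $$ (e i, e j))"

end

theory Submission
  imports Defs "Jordan_Normal_Form.Jordan_Normal_Form_Existence"
begin

text \<open>Every expansive \<open>A\<close> has the quasi-norm \<open>\<bar>det A\<bar>\<^sup>j\<close>, \<open>j\<close> being the last integer with
  \<open>\<parallel>A\<^sup>-\<^sup>j x\<parallel> \<ge> 1\<close>. Hence \<open>A\<close> and \<open>B\<close> are equivalent through \<open>S\<close> as soon as \<open>B\<^sup>-\<^sup>m S A\<^sup>k\<close> and its inverse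
  stay bounded while \<open>\<bar>det B\<bar>\<^sup>m\<close> and \<open>\<bar>det A\<bar>\<^sup>k\<close> stay comparable. A Jordan block with eigenvalue
  \<open>\<mu>\<close> is similar to \<open>\<mu> exp(c N)\<close>, with \<open>N\<close> the nilpotent shift and any \<open>c \<noteq> 0\<close>. So for
  \<open>t = ln 2 / ln \<bar>det A\<bar>\<close>, replacing each complex eigenvalue \<open>\<mu>\<close> by \<open>\<bar>\<mu>\<bar>\<^sup>t\<close> (and choosing \<open>c = 1\<close> for
  \<open>A\<close>, \<open>c = t\<close> for \<open>B\<close>) gives a complex intertwining \<open>S\<close>; since \<open>det (Re S + z Im S)\<close> is a nonzero
  polynomial in \<open>z\<close>, some real \<open>Re S + z Im S\<close> is invertible.

  Conversely, an arbitrary quasi-norm is bounded on bounded sets and has bounded sublevel sets, so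
  an equivalence of dilations of determinant 2 yields \<open>\<parallel>B\<^sup>n S y\<parallel> \<le> C \<parallel>A\<^sup>n y\<parallel>\<close>. The vectors with
  orbits of growth at most \<open>r\<^sup>n n\<^sup>p\<close> are therefore mapped to vectors of the same kind, and their
  dimensions, for all \<open>r\<close> and \<open>p\<close>, determine the Jordan blocks.\<close>

text \<open>In flow coordinates \<open>B^-m S A^k\<close> has entries of modulus
  \<open>|\<mu>|^u |u|^d / d!\<close> with \<open>u = k - m t\<close>: the choice of the two
  constants \<open>c\<close> makes the nilpotent exponents combine to the same \<open>u\<close> as
  the moduli, and the arguments of the eigenvalues disappear in the modulus. Because ln |det B| = t
  ln |det A|, comparability of the determinant powers says exactly that \<open>u\<close> is bounded.
  Passing from a complex to a real intertwining preserves upper bounds on entries but gives no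
  control of the inverse. That control comes from Cramer's rule, since the determinant of
  \<open>B^-m S A^k\<close> stays away from 0. The two directions treat quasi-norms differently.
  Existence may choose convenient ones; uniqueness has to accept any measurable ones, with neither
  continuity nor symmetry at hand. Measure theory supplies a bound on the unit ball, homogeneity
  turns it into continuity at 0, and this much continuity suffices for compactness arguments. The
  common determinant 2 lets a single exponent \<open>n\<close> serve both dilations, so that growth
  rates of forward orbits can be compared directly.\<close>

hide_const (open) Matrix.mat Matrix.vec Determinant.det
hide_fact (open) Matrix.vec_eq_iff Matrix.mat_def Matrix.vec_def Determinant.det_def
no_notation Matrix.vec_index (infixl "$" 100)

section \<open>Determinants, inverses and complexification\<close>

text \<open>A nonzero Leibniz term forces \<open>r i \<le> r (p i)\<close> for all \<open>i\<close>,
  strictly where \<open>p\<close> moves \<open>i\<close>, whereas a permutation preserves the sum of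
  the ranks. Ties in \<open>r\<close> are allowed, so the position inside a block can serve as rank
  for all blocks at once.\<close>

lemma det_triangular_rank:
  fixes A :: "'a::comm_ring_1^'n^'n" and r :: "'n \<Rightarrow> nat"
  assumes A: "\<And>i j. i \<noteq> j \<Longrightarrow> r j \<le> r i \<Longrightarrow> A $ i $ j = 0"
  shows "det A = (\<Prod>i\<in>UNIV. A $ i $ i)"
proof -
  have "(\<Prod>i\<in>UNIV. A $ i $ p i) = 0" if p: "p permutes UNIV" "p \<noteq> id" for p
  proof (rule ccontr)
    assume "(\<Prod>i\<in>UNIV. A $ i $ p i) \<noteq> 0"
    then have nz: "A $ i $ p i \<noteq> 0" for i
      by (metis UNIV_I finite prod_zero)
    have le: "r i \<le> r (p i)" for i
      using A[of i "p i"] nz[of i] by (cases "p i = i") (auto intro: leI)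
    have "(\<Sum>i\<in>UNIV. r (p i)) = (\<Sum>i\<in>UNIV. r i)"
      using sum.permute[OF p(1), of r] by simp
    moreover obtain i where "p i \<noteq> i" using p(2) by (metis eq_id_iff)
    then have "r i < r (p i)" using A[of i "p i"] nz[of i] by (metis leI)
    then have "(\<Sum>i\<in>UNIV. r i) < (\<Sum>i\<in>UNIV. r (p i))"
      by (intro sum_strict_mono_ex1) (use le in auto)
    ultimately show False by simp
  qed
  then have "det A = (\<Sum>p\<in>{id}. of_int (sign p) * (\<Prod>i\<in>UNIV. A $ i $ p i))"
    unfolding det_def
    by (intro sum.mono_neutral_right) (auto simp: finite_permutations permutes_id)
  then show ?thesis by (simp add: sign_id)
qed

lemma det_map_matrix_of_real:
  fixes A :: "real^'n^'n"
  shows "det (map_matrix complex_of_real A) = complex_of_real (det A)"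
  unfolding det_def by (simp add: map_matrix_def)

lemma invertible_of_real:
  fixes A :: "real^'n^'n"
  assumes "invertible A"
  shows "invertible (map_matrix complex_of_real A)"
  using assms by (simp add: invertible_det_nz det_map_matrix_of_real)

lemma map_matrix_of_real_mult:
  fixes A B :: "real^'n^'n"
  shows "map_matrix complex_of_real (A ** B)
    = map_matrix complex_of_real A ** map_matrix complex_of_real B"
  by (simp add: vec_eq_iff matrix_matrix_mult_def)

lemma map_matrix_of_real_one: "map_matrix complex_of_real (mat 1 :: real^'n^'n) = mat 1"
  by (simp add: vec_eq_iff mat_def)

lemma det_eq_of_intertwine:
  fixes A B P :: "'a::field^'n^'n"
  assumes "invertible P" "A ** P = P ** B"
  shows "det A = det B"
proof -
  have "det A * det P = det P * det B"
    using assms(2) by (metis det_mul)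
  then show ?thesis using assms(1) by (simp add: invertible_det_nz)
qed

lemma matrix_inv_left: "invertible A \<Longrightarrow> matrix_inv A ** A = mat 1"
  and matrix_inv_right: "invertible A \<Longrightarrow> A ** matrix_inv A = mat 1"
  for A :: "'a::field^'n^'n"
  unfolding invertible_def matrix_inv_def by (metis (mono_tags, lifting) someI_ex)+

lemma invertible_matrix_inv: "invertible A \<Longrightarrow> invertible (matrix_inv A)"
  for A :: "'a::field^'n^'n"
  using matrix_inv_left matrix_inv_right unfolding invertible_def by blast

section \<open>Integer powers of matrices\<close>

definition zpow :: "'a::field^'n^'n \<Rightarrow> int \<Rightarrow> 'a^'n^'n" where
  "zpow A k = (if 0 \<le> k then ((**) A ^^ nat k) (mat 1)
     else ((**) (matrix_inv A) ^^ nat (- k)) (mat 1))"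

lemma zpow_0 [simp]: "zpow A 0 = mat 1"
  by (simp add: zpow_def)

lemma zpow_Suc:
  assumes "invertible A"
  shows "zpow A (k + 1) = A ** zpow A k"
proof -
  consider "k \<ge> 0" | "k = -1" | "k < -1" by linarith
  then show ?thesis
  proof cases
    case 1
    then show ?thesis by (simp add: zpow_def nat_add_distrib)
  next
    case 2
    then show ?thesis using assms by (simp add: zpow_def matrix_inv_right)
  next
    case 3
    then have "nat (- k) = Suc (nat (- (k + 1)))" by simp
    then show ?thesis
      using 3 assms by (simp add: zpow_def matrix_mul_assoc matrix_inv_right)
  qed
qed

text \<open>Invertibility makes the recursion run both ways. The exponent law, the transfer along
  intertwinings, complexification and the flow form of Jordan matrices all follow by choosing
  \<open>F\<close>.\<close>

lemma zpow_unique: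
  assumes inv: "invertible A" and step: "\<And>k. F (k + 1) = A ** F k"
  shows "F k = zpow A k ** F 0"
proof (induction k rule: int_induct[where k = 0])
  case base
  then show ?case by simp
next
  case (step1 i)
  then show ?case by (simp add: step zpow_Suc[OF inv] matrix_mul_assoc)
next
  case (step2 i)
  have "A ** F (i - 1) = A ** (zpow A (i - 1) ** F 0)"
    using step2 step[of "i - 1"] zpow_Suc[OF inv, of "i - 1"] by (simp add: matrix_mul_assoc)
  then have "(matrix_inv A ** A) ** F (i - 1) = (matrix_inv A ** A) ** (zpow A (i - 1) ** F 0)"
    by (simp flip: matrix_mul_assoc)
  then show ?case using inv by (simp add: matrix_inv_left)
qed

lemma zpow_add:
  assumes "invertible A"
  shows "zpow A (k + l) = zpow A k ** zpow A l"
  using zpow_unique[OF assms, of "\<lambda>k. zpow A (k + l)" k] zpow_Suc[OF assms, of "k + l" for k]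
  by (simp add: ac_simps)

lemma zpow_minus_left: "invertible A \<Longrightarrow> zpow A (- k) ** zpow A k = mat 1"
  using zpow_add[of A "- k" k] by simp

lemma zpow_intertwine:
  assumes "invertible A" "invertible B" "A ** P = P ** B"
  shows "zpow A k ** P = P ** zpow B k"
proof -
  have "P ** zpow B (k + 1) = A ** (P ** zpow B k)" for k
    using assms by (simp add: zpow_Suc matrix_mul_assoc)
  from zpow_unique[where F = "\<lambda>k. P ** zpow B k", OF assms(1) this] show ?thesis by simp
qed

lemma det_zpow:
  fixes A :: "'a::field^'n^'n"
  assumes "invertible A"
  shows "det (zpow A k) = det A powi k"
proof (induction k rule: int_induct[where k = 0])
  case (step1 i)
  then show ?case
    using assms by (simp add: zpow_Suc det_mul power_int_add_1' invertible_det_nz)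
next
  case (step2 i)
  have "det A * det (zpow A (i - 1)) = det A * det A powi (i - 1)"
    using step2 zpow_Suc[OF assms, of "i - 1"] assms power_int_add_1'[of "det A" "i - 1"]
    by (simp add: det_mul invertible_det_nz)
  then show ?case using assms by (simp add: invertible_det_nz)
qed simp

lemma map_matrix_zpow:
  fixes A :: "real^'n^'n"
  assumes "invertible A"
  shows "map_matrix complex_of_real (zpow A k) = zpow (map_matrix complex_of_real A) k"
  using zpow_unique[OF invertible_of_real[OF assms], of "\<lambda>k. map_matrix complex_of_real (zpow A k)" k]
  by (simp add: zpow_Suc[OF assms] map_matrix_of_real_mult map_matrix_of_real_one)

section \<open>Block Toeplitz matrices\<close>

text \<open>A coordinate is a pair (block, position in the block). Only a bijection is asked for, no
  ordering of the coordinates, so blocks can be relabelled without changing a matrix.\<close>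

definition block_coords :: "('n::finite \<Rightarrow> nat \<times> nat) \<Rightarrow> nat \<Rightarrow> (nat \<Rightarrow> nat) \<Rightarrow> bool" where
  "block_coords \<beta> K s \<longleftrightarrow> bij_betw \<beta> UNIV (SIGMA b:{..<K}. {..<s b})"

text \<open>Block \<open>b\<close> is the power series \<open>f b\<close> evaluated at the nilpotent
  shift. Rows and columns carry separate labellings so that one dilation's blocks can be matched
  with another's; with \<open>f = 1\<close> this is a permutation matrix if both labellings have the
  same block sizes.\<close>

definition toeplitz ::
  "('n \<Rightarrow> nat \<times> nat) \<Rightarrow> ('n \<Rightarrow> nat \<times> nat) \<Rightarrow> (nat \<Rightarrow> 'a::zero fps) \<Rightarrow> 'a^'n^'n" where
  "toeplitz \<beta> \<gamma> f = (\<chi> i j. if fst (\<beta> i) = fst (\<gamma> j) \<and> snd (\<beta> i) \<le> snd (\<gamma> j)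
     then fps_nth (f (fst (\<gamma> j))) (snd (\<gamma> j) - snd (\<beta> i)) else 0)"

definition subst_matrix ::
  "('n \<Rightarrow> nat \<times> nat) \<Rightarrow> (nat \<Rightarrow> 'a::comm_semiring_1 fps) \<Rightarrow> 'a^'n^'n" where
  "subst_matrix \<beta> g = (\<chi> i j. if fst (\<beta> i) = fst (\<beta> j)
     then fps_nth (g (fst (\<beta> j)) ^ snd (\<beta> i)) (snd (\<beta> j)) else 0)"

lemma block_coords_inj: "block_coords \<beta> K s \<Longrightarrow> \<beta> i = \<beta> j \<longleftrightarrow> i = j"
  unfolding block_coords_def bij_betw_def by (auto simp: inj_on_def)

lemma block_coords_less:
  assumes "block_coords \<beta> K s"
  shows "fst (\<beta> i) < K" "snd (\<beta> i) < s (fst (\<beta> i))"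
proof -
  have "\<beta> i \<in> (SIGMA b:{..<K}. {..<s b})"
    using assms unfolding block_coords_def bij_betw_def by auto
  then show "fst (\<beta> i) < K" "snd (\<beta> i) < s (fst (\<beta> i))" by (auto split: prod.splits)
qed

lemma sum_block_coords:
  fixes h :: "nat \<Rightarrow> 'a::comm_monoid_add"
  assumes \<beta>: "block_coords \<beta> K s" and b: "b < K"
  shows "(\<Sum>m\<in>UNIV. if fst (\<beta> m) = b then h (snd (\<beta> m)) else 0) = (\<Sum>l<s b. h l)"
proof -
  have "(\<Sum>m\<in>UNIV. if fst (\<beta> m) = b then h (snd (\<beta> m)) else 0)
      = (\<Sum>x\<in>(SIGMA b:{..<K}. {..<s b}). if fst x = b then h (snd x) else 0)"
    using sum.reindex_bij_betw[OF \<beta>[unfolded block_coords_def],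
      of "\<lambda>x. if fst x = b then h (snd x) else 0"] .
  also have "\<dots> = (\<Sum>c<K. \<Sum>l<s c. if c = b then h l else 0)"
    by (subst sum.Sigma) (auto simp: case_prod_unfold)
  also have "\<dots> = (\<Sum>c<K. if c = b then (\<Sum>l<s b. h l) else 0)"
    by (intro sum.cong) auto
  also have "\<dots> = (\<Sum>l<s b. h l)"
    using b by simp
  finally show ?thesis .
qed

lemma prod_block_coords:
  fixes h :: "nat \<times> nat \<Rightarrow> 'a::comm_monoid_mult"
  assumes \<beta>: "block_coords \<beta> K s"
  shows "(\<Prod>m\<in>UNIV. h (\<beta> m)) = (\<Prod>b<K. \<Prod>l<s b. h (b, l))"
  using prod.reindex_bij_betw[OF \<beta>[unfolded block_coords_def], of h]
  by (subst prod.Sigma) (auto simp: case_prod_unfold)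

text \<open>Power series in one nilpotent shift multiply by the Cauchy product. Truncation at the
  block size loses nothing, since the intermediate positions lie between those of the row and the
  column.\<close>

lemma toeplitz_mult:
  fixes f g :: "nat \<Rightarrow> 'a::comm_semiring_1 fps"
  assumes \<gamma>: "block_coords \<gamma> K s" and \<delta>: "block_coords \<delta> K s"
  shows "toeplitz \<beta> \<gamma> f ** toeplitz \<gamma> \<delta> g = toeplitz \<beta> \<delta> (\<lambda>b. f b * g b)"
proof -
  have "(toeplitz \<beta> \<gamma> f ** toeplitz \<gamma> \<delta> g) $ i $ j = toeplitz \<beta> \<delta> (\<lambda>b. f b * g b) $ i $ j" for i j
  proof -
    define b where "b = fst (\<delta> j)"
    define p where "p = snd (\<beta> i)"
    define q where "q = snd (\<delta> j)"
    have bK: "b < K" and q: "q < s b"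
      using block_coords_less[OF \<delta>, of j] by (auto simp: b_def q_def)
    show ?thesis
    proof (cases "fst (\<beta> i) = b \<and> p \<le> q")
      case True
      have "(toeplitz \<beta> \<gamma> f ** toeplitz \<gamma> \<delta> g) $ i $ j
          = (\<Sum>m\<in>UNIV. if fst (\<gamma> m) = b then (if p \<le> snd (\<gamma> m) \<and> snd (\<gamma> m) \<le> q
              then fps_nth (f b) (snd (\<gamma> m) - p) * fps_nth (g b) (q - snd (\<gamma> m)) else 0) else 0)"
        unfolding matrix_matrix_mult_def toeplitz_def using True
        by (auto simp: b_def p_def q_def intro!: sum.cong)
      also have "\<dots> = (\<Sum>l<s b. if p \<le> l \<and> l \<le> q then fps_nth (f b) (l - p) * fps_nth (g b) (q - l) else 0)"
        by (rule sum_block_coords[OF \<gamma> bK])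
      also have "\<dots> = (\<Sum>l=p..q. fps_nth (f b) (l - p) * fps_nth (g b) (q - l))"
        using q by (intro sum.mono_neutral_cong_right) auto
      also have "\<dots> = (\<Sum>l=0..q-p. fps_nth (f b) l * fps_nth (g b) (q - p - l))"
        using True by (intro sum.reindex_bij_witness[of _ "\<lambda>l. l + p" "\<lambda>l. l - p"]) auto
      also have "\<dots> = toeplitz \<beta> \<delta> (\<lambda>b. f b * g b) $ i $ j"
        using True by (simp add: toeplitz_def fps_mult_nth b_def p_def q_def)
      finally show ?thesis .
    next
      case False
      then have "(toeplitz \<beta> \<gamma> f ** toeplitz \<gamma> \<delta> g) $ i $ j = 0"
        unfolding matrix_matrix_mult_def toeplitz_def b_def p_def q_def
        by (auto intro!: sum.neutral)
      then show ?thesis using False by (auto simp: toeplitz_def b_def p_def q_def)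
    qed
  qed
  then show ?thesis by (simp add: vec_eq_iff)
qed

lemma toeplitz_one:
  assumes "block_coords \<beta> K s"
  shows "toeplitz \<beta> \<beta> (\<lambda>_. 1 :: 'a::comm_semiring_1 fps) = mat 1"
  using block_coords_inj[OF assms]
  by (auto simp: vec_eq_iff toeplitz_def mat_def fps_one_nth prod_eq_iff)

lemma toeplitz_cong:
  assumes "block_coords \<gamma> K s" "\<And>b. b < K \<Longrightarrow> f b = g b"
  shows "toeplitz \<beta> \<gamma> f = toeplitz \<beta> \<gamma> g"
  using block_coords_less[OF assms(1)] assms(2) by (auto simp: toeplitz_def vec_eq_iff)

lemma invertible_toeplitz_one:
  assumes "block_coords \<beta> K s" "block_coords \<gamma> K s"
  shows "invertible (toeplitz \<beta> \<gamma> (\<lambda>_. 1 :: 'a::comm_semiring_1 fps))"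
  unfolding invertible_def using assms
  by (intro exI[of _ "toeplitz \<gamma> \<beta> (\<lambda>_. 1)"]) (simp add: toeplitz_mult toeplitz_one)

lemma det_toeplitz:
  fixes f :: "nat \<Rightarrow> 'a::comm_ring_1 fps"
  assumes "block_coords \<beta> K s"
  shows "det (toeplitz \<beta> \<beta> f) = (\<Prod>i\<in>UNIV. fps_nth (f (fst (\<beta> i))) 0)"
proof -
  have "toeplitz \<beta> \<beta> f $ i $ j = 0" if "i \<noteq> j" "snd (\<beta> j) \<le> snd (\<beta> i)" for i j
    using that block_coords_inj[OF assms, of i j] by (auto simp: toeplitz_def prod_eq_iff)
  from det_triangular_rank[of "\<lambda>i. snd (\<beta> i)", OF this] show ?thesis
    by (simp add: toeplitz_def)
qed

text \<open>With zero constant term, \<open>g ^ l\<close> starts at degree \<open>l\<close> with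
  coefficient \<open>fps_nth g 1 ^ l\<close>; the matrix is therefore triangular with nonzero
  diagonal.\<close>

lemma invertible_subst_matrix:
  fixes g :: "nat \<Rightarrow> 'a::field fps"
  assumes \<beta>: "block_coords \<beta> K s" and g0: "\<And>b. b < K \<Longrightarrow> fps_nth (g b) 0 = 0"
    and g1: "\<And>b. b < K \<Longrightarrow> fps_nth (g b) 1 \<noteq> 0"
  shows "invertible (subst_matrix \<beta> g)"
proof -
  have "subst_matrix \<beta> g $ i $ j = 0" if "i \<noteq> j" "snd (\<beta> j) \<le> snd (\<beta> i)" for i j
    using that block_coords_inj[OF \<beta>, of i j]
      startsby_zero_power_prefix[OF g0[OF block_coords_less(1)[OF \<beta>]]]
    by (auto simp: subst_matrix_def prod_eq_iff)
  from det_triangular_rank[of "\<lambda>i. snd (\<beta> i)", OF this]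
  have "det (subst_matrix \<beta> g) = (\<Prod>i\<in>UNIV. fps_nth (g (fst (\<beta> i)) ^ snd (\<beta> i)) (snd (\<beta> i)))"
    by (simp add: subst_matrix_def)
  also have "\<dots> = (\<Prod>i\<in>UNIV. fps_nth (g (fst (\<beta> i))) 1 ^ snd (\<beta> i))"
    using block_coords_less(1)[OF \<beta>] g0
    by (intro prod.cong) (auto simp: startsby_zero_power_nth_same)
  also have "\<dots> \<noteq> 0"
    using block_coords_less(1)[OF \<beta>] g1 by simp
  finally show ?thesis by (simp add: invertible_det_nz)
qed

text \<open>Let the rows of a block stand for the powers of \<open>X\<close>, so that \<^const>\<open>toeplitz\<close> acts as
  multiplication by \<open>f\<close>. Then \<^const>\<open>subst_matrix\<close> acts as the substitution
  \<open>X \<mapsto> g\<close>, which is a ring homomorphism.\<close>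

lemma toeplitz_subst_matrix:
  fixes f g :: "nat \<Rightarrow> 'a::field fps"
  assumes \<beta>: "block_coords \<beta> K s" and g0: "\<And>b. b < K \<Longrightarrow> fps_nth (g b) 0 = 0"
  shows "toeplitz \<beta> \<beta> f ** subst_matrix \<beta> g = subst_matrix \<beta> g ** toeplitz \<beta> \<beta> (\<lambda>b. f b oo g b)"
proof -
  have "(toeplitz \<beta> \<beta> f ** subst_matrix \<beta> g) $ i $ j
      = (subst_matrix \<beta> g ** toeplitz \<beta> \<beta> (\<lambda>b. f b oo g b)) $ i $ j" for i j
  proof -
    define b where "b = fst (\<beta> j)"
    define p where "p = snd (\<beta> i)"
    define q where "q = snd (\<beta> j)"
    have bK: "b < K" and q: "q < s b"
      using block_coords_less[OF \<beta>, of j] by (auto simp: b_def q_def)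
    \<comment> \<open>Row \<open>p\<close> of either product lists the coefficients of
      \<open>(f b oo g b) * g b ^ p\<close>, the image of \<open>X ^ p * f b\<close> under the
      substitution.\<close>
    have shift: "fps_nth (g b ^ (l + p)) q
        = (\<Sum>m=0..q. fps_nth (g b ^ p) m * fps_nth (g b ^ l) (q - m))" for l
      by (simp add: power_add mult.commute[of "g b ^ l" "g b ^ p"] fps_mult_nth)
    note z = startsby_zero_power_prefix[OF g0[OF bK], rule_format]
    show ?thesis
    proof (cases "fst (\<beta> i) = b")
      case True
      have "(toeplitz \<beta> \<beta> f ** subst_matrix \<beta> g) $ i $ j
          = (\<Sum>m\<in>UNIV. if fst (\<beta> m) = b then (if p \<le> snd (\<beta> m)
              then fps_nth (f b) (snd (\<beta> m) - p) * fps_nth (g b ^ snd (\<beta> m)) q else 0) else 0)"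
        unfolding matrix_matrix_mult_def toeplitz_def subst_matrix_def using True
        by (auto simp: b_def p_def q_def intro!: sum.cong)
      also have "\<dots> = (\<Sum>l<s b. if p \<le> l then fps_nth (f b) (l - p) * fps_nth (g b ^ l) q else 0)"
        by (rule sum_block_coords[OF \<beta> bK])
      \<comment> \<open>Indices \<open>l > q\<close> contribute nothing because
        \<open>g b ^ l\<close> has no terms below degree \<open>l\<close>; the block size can thus
        be exchanged for a range that shifts cleanly to \<open>{0..q}\<close>.\<close>
      also have "\<dots> = (\<Sum>l=p..p+q. fps_nth (f b) (l - p) * fps_nth (g b ^ l) q)"
        using q z[of q] by (intro sum.mono_neutral_cong) auto
      also have "\<dots> = (\<Sum>l=0..q. fps_nth (f b) l * fps_nth (g b ^ (l + p)) q)"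
        by (intro sum.reindex_bij_witness[of _ "\<lambda>l. l + p" "\<lambda>l. l - p"]) auto
      also have "\<dots> = (\<Sum>l=0..q. \<Sum>m=0..q. fps_nth (f b) l * (fps_nth (g b ^ p) m * fps_nth (g b ^ l) (q - m)))"
        by (simp add: shift sum_distrib_left)
      also have "\<dots> = (\<Sum>m=0..q. \<Sum>l=0..q. fps_nth (f b) l * (fps_nth (g b ^ p) m * fps_nth (g b ^ l) (q - m)))"
        by (rule sum.swap)
      also have "\<dots> = (\<Sum>m=0..q. fps_nth (g b ^ p) m * fps_nth (f b oo g b) (q - m))"
      proof (intro sum.cong refl)
        fix m assume "m \<in> {0..q}"
        have "(\<Sum>l=0..q. fps_nth (f b) l * fps_nth (g b ^ l) (q - m))
            = (\<Sum>l=0..q-m. fps_nth (f b) l * fps_nth (g b ^ l) (q - m))"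
          using z[of "q - m"] by (intro sum.mono_neutral_right) auto
        moreover have "(\<Sum>l=0..q. fps_nth (f b) l * (fps_nth (g b ^ p) m * fps_nth (g b ^ l) (q - m)))
            = fps_nth (g b ^ p) m * (\<Sum>l=0..q. fps_nth (f b) l * fps_nth (g b ^ l) (q - m))"
          by (simp add: sum_distrib_left mult.left_commute)
        ultimately show "(\<Sum>l=0..q. fps_nth (f b) l * (fps_nth (g b ^ p) m * fps_nth (g b ^ l) (q - m)))
            = fps_nth (g b ^ p) m * fps_nth (f b oo g b) (q - m)"
          by (simp add: fps_compose_nth)
      qed
      also have "\<dots> = (\<Sum>m<s b. if m \<le> q then fps_nth (g b ^ p) m * fps_nth (f b oo g b) (q - m) else 0)"
        using q by (intro sum.mono_neutral_cong_left) auto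
      also have "\<dots> = (\<Sum>m\<in>UNIV. if fst (\<beta> m) = b then (if snd (\<beta> m) \<le> q
              then fps_nth (g b ^ p) (snd (\<beta> m)) * fps_nth (f b oo g b) (q - snd (\<beta> m)) else 0) else 0)"
        by (rule sum_block_coords[OF \<beta> bK, symmetric])
      also have "\<dots> = (subst_matrix \<beta> g ** toeplitz \<beta> \<beta> (\<lambda>b. f b oo g b)) $ i $ j"
        unfolding matrix_matrix_mult_def toeplitz_def subst_matrix_def using True
        by (auto simp: b_def p_def q_def intro!: sum.cong)
      finally show ?thesis .
    next
      case False
      have "(toeplitz \<beta> \<beta> f ** subst_matrix \<beta> g) $ i $ j = 0"
        unfolding matrix_matrix_mult_def toeplitz_def subst_matrix_def
        using False by (auto simp: b_def intro!: sum.neutral)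
      moreover have "(subst_matrix \<beta> g ** toeplitz \<beta> \<beta> (\<lambda>b. f b oo g b)) $ i $ j = 0"
        unfolding matrix_matrix_mult_def toeplitz_def subst_matrix_def
        using False by (auto simp: b_def intro!: sum.neutral)
      ultimately show ?thesis by simp
    qed
  qed
  then show ?thesis by (simp add: vec_eq_iff)
qed

section \<open>Jordan matrices as exponential flows\<close>

definition exp_series :: "'a \<Rightarrow> 'a \<Rightarrow> 'a::field_char_0 fps" where
  "exp_series a c = fps_const a * fps_exp c"

lemma fps_nth_exp_series: "fps_nth (exp_series a c) d = a * c ^ d / fact d"
  by (simp add: exp_series_def)

lemma exp_series_mult: "exp_series a c * exp_series b d = exp_series (a * b) (c + d)"
proof -
  have "exp_series a c * exp_series b d = (fps_const a * fps_const b) * (fps_exp c * fps_exp d)"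
    unfolding exp_series_def by (simp only: ac_simps)
  then show ?thesis by (simp add: exp_series_def fps_exp_add_mult)
qed

abbreviation jordan_toeplitz ::
  "('n \<Rightarrow> nat \<times> nat) \<Rightarrow> (nat \<Rightarrow> 'a::comm_ring_1) \<Rightarrow> 'a^'n^'n" where
  "jordan_toeplitz \<beta> \<mu> \<equiv> toeplitz \<beta> \<beta> (\<lambda>b. fps_const (\<mu> b) + fps_X)"

lemma det_jordan_toeplitz:
  assumes "block_coords \<beta> K s"
  shows "det (jordan_toeplitz \<beta> \<mu>) = (\<Prod>i\<in>UNIV. \<mu> (fst (\<beta> i)))"
  using det_toeplitz[OF assms, of "\<lambda>b. fps_const (\<mu> b) + fps_X"] by simp

lemma invertible_jordan_toeplitz:
  fixes \<mu> :: "nat \<Rightarrow> 'a::field"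
  assumes "block_coords \<beta> K s" "\<And>b. b < K \<Longrightarrow> \<mu> b \<noteq> 0"
  shows "invertible (jordan_toeplitz \<beta> \<mu>)"
  using assms block_coords_less(1)[OF assms(1)] by (auto simp: invertible_det_nz det_jordan_toeplitz)

text \<open>The substitution \<open>X \<mapsto> \<mu> (exp (c X) - 1)\<close> turns a Jordan matrix into the time-one map of
  an explicit flow.\<close>

lemma zpow_jordan_toeplitz:
  fixes \<mu> :: "nat \<Rightarrow> 'a::field_char_0"
  assumes \<beta>: "block_coords \<beta> K s" and \<mu>: "\<And>b. b < K \<Longrightarrow> \<mu> b \<noteq> 0" and c: "c \<noteq> 0"
  obtains C where "invertible C"
    "\<And>k. zpow (jordan_toeplitz \<beta> \<mu>) k ** C
       = C ** toeplitz \<beta> \<beta> (\<lambda>b. exp_series (\<mu> b powi k) (of_int k * c))"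
proof -
  define g where "g = (\<lambda>b. fps_const (\<mu> b) * (fps_exp c - 1))"
  define C where "C = subst_matrix \<beta> g"
  define E where "E = (\<lambda>k. toeplitz \<beta> \<beta> (\<lambda>b. exp_series (\<mu> b powi k) (of_int k * c)))"
  have g0: "fps_nth (g b) 0 = 0" for b by (simp add: g_def)
  \<comment> \<open>The linear coefficient of \<open>g b\<close> is \<open>\<mu> b * c\<close>,
    which is where both nonvanishing hypotheses enter.\<close>
  have C: "invertible C"
    unfolding C_def using \<mu> c by (intro invertible_subst_matrix[OF \<beta> g0]) (auto simp: g_def)
  have comp: "(fps_const (\<mu> b) + fps_X) oo g b = exp_series (\<mu> b) c" for b
    using g0[of b] by (simp add: fps_compose_add_distrib exp_series_def g_def algebra_simps)
  have inter: "jordan_toeplitz \<beta> \<mu> ** C = C ** toeplitz \<beta> \<beta> (\<lambda>b. exp_series (\<mu> b) c)"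
    unfolding C_def toeplitz_subst_matrix[OF \<beta> g0] comp ..
  have step: "toeplitz \<beta> \<beta> (\<lambda>b. exp_series (\<mu> b) c) ** E k = E (k + 1)" for k
    unfolding E_def toeplitz_mult[OF \<beta> \<beta>]
    by (rule toeplitz_cong[OF \<beta>])
      (use \<mu> in \<open>simp add: exp_series_mult power_int_add algebra_simps\<close>)
  have "C ** E (k + 1) = jordan_toeplitz \<beta> \<mu> ** (C ** E k)" for k
    by (simp add: matrix_mul_assoc inter flip: step)
  then have "C ** E k = zpow (jordan_toeplitz \<beta> \<mu>) k ** (C ** E 0)" for k
    by (rule zpow_unique[OF invertible_jordan_toeplitz[OF \<beta> \<mu>], rotated])
  moreover have "E 0 = mat 1"
    using toeplitz_one[OF \<beta>] by (simp add: E_def exp_series_def)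
  ultimately show ?thesis using that[OF C] by (simp add: E_def)
qed

section \<open>The canonical quasi-norm\<close>

text \<open>The eigenvalue condition in the form in which quasi-norm arguments use it: uniform decay
  of the inverse powers, without a rate.\<close>

definition expanding :: "real^'n^'n \<Rightarrow> bool" where
  "expanding A \<longleftrightarrow> invertible A \<and> 1 < \<bar>det A\<bar> \<and>
     (\<forall>\<epsilon>>0. \<exists>m::nat. \<forall>k\<ge>m. \<forall>x. norm (zpow A (- int k) *v x) \<le> \<epsilon> * norm x)"

text \<open>The norms along an orbit need not be monotone. Taking the last crossing of 1 still makes
  the level increase by exactly one under \<open>A\<close>.\<close>

definition level :: "real^'n^'n \<Rightarrow> real^'n \<Rightarrow> int" where
  "level A x = (THE j. 1 \<le> norm (zpow A (- j) *v x) \<and> (\<forall>i>j. norm (zpow A (- i) *v x) < 1))"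

definition level_norm :: "real^'n^'n \<Rightarrow> real^'n \<Rightarrow> real" where
  "level_norm A x = (if x = 0 then 0 else \<bar>det A\<bar> powi level A x)"

lemma zpow_shift:
  assumes "invertible A"
  shows "zpow A (k + l) *v x = zpow A k *v (zpow A l *v x)"
  by (simp add: zpow_add[OF assms] matrix_vector_mul_assoc)

lemma level_eqI:
  assumes "1 \<le> norm (zpow A (- j) *v x)" "\<And>i. i > j \<Longrightarrow> norm (zpow A (- i) *v x) < 1"
  shows "level A x = j"
  unfolding level_def using assms by (intro the_equality) (auto, metis not_less linorder_neqE)

lemma level_attained:
  assumes A: "expanding A" and x: "x \<noteq> 0"
  shows "1 \<le> norm (zpow A (- level A x) *v x)"
    and "i > level A x \<Longrightarrow> norm (zpow A (- i) *v x) < 1"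
proof -
  have inv: "invertible A" using A by (simp add: expanding_def)
  define f where "f = (\<lambda>j. norm (zpow A (- j) *v x))"
  have decay: "\<exists>m::nat. \<forall>k\<ge>m. \<forall>j. f (j + int k) \<le> \<epsilon> * f j" if eps: "\<epsilon> > 0" for \<epsilon>
  proof -
    obtain m :: nat where m: "\<forall>k\<ge>m. \<forall>x. norm (zpow A (- int k) *v x) \<le> \<epsilon> * norm x"
      using A eps unfolding expanding_def by blast
    have "f (j + int k) \<le> \<epsilon> * f j" if "k \<ge> m" for k j
    proof -
      have "- (j + int k) = - int k + - j" by simp
      then show ?thesis
        using m[rule_format, OF that, of "zpow A (- j) *v x"]
        by (simp only: f_def zpow_shift[OF inv])
    qed
    then show ?thesis by blast
  qed
  have f0: "f 0 > 0" using x by (simp add: f_def)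
  \<comment> \<open>With contraction factor \<open>f 0\<close>, the step from \<open>- m\<close> to
    0 reads \<open>f 0 \<le> f 0 * f (- m)\<close>, so the orbit reaches norm 1 at
    \<open>- m\<close>.\<close>
  obtain m where "\<forall>k\<ge>m. \<forall>j. f (j + int k) \<le> f 0 * f j" using decay[OF f0] by blast
  from this[rule_format, of m "- int m"] have low: "f (- int m) \<ge> 1" using f0 by simp
  \<comment> \<open>This factor brings \<open>f\<close> down from \<open>f 0\<close> to at most
    1/2.\<close>
  obtain m' where m': "\<forall>k\<ge>m'. \<forall>j. f (j + int k) \<le> (1 / (2 * f 0)) * f j"
    using decay[of "1 / (2 * f 0)"] f0 by auto
  have high: "f i < 1" if "i \<ge> int m'" for i
    using m'[rule_format, of "nat i" 0] f0 that by (auto simp: le_nat_iff)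
  define S where "S = {j \<in> {- int m..int m'}. f j \<ge> 1}"
  define l where "l = Max S"
  have "finite S" by (rule finite_subset[of _ "{- int m..int m'}"]) (auto simp: S_def)
  moreover have "- int m \<in> S" using low high[of "- int m"] by (auto simp: S_def)
  ultimately have "finite S" "S \<noteq> {}" by auto
  then have "l \<in> S" and max: "\<And>j. j \<in> S \<Longrightarrow> j \<le> l" unfolding l_def by auto
  have top: "f i < 1" if "i > l" for i
  proof (rule ccontr)
    assume "\<not> f i < 1"
    then have "i \<in> S" using high[of i] that \<open>l \<in> S\<close> by (force simp: S_def)
    then show False using max that by fastforce
  qed
  have "level A x = l"
    using \<open>l \<in> S\<close> top by (intro level_eqI) (auto simp: S_def f_def)
  then show "1 \<le> norm (zpow A (- level A x) *v x)"
    "i > level A x \<Longrightarrow> norm (zpow A (- i) *v x) < 1"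
    using \<open>l \<in> S\<close> top by (auto simp: S_def f_def)
qed

lemma level_ge:
  assumes A: "expanding A" and j: "1 \<le> norm (zpow A (- j) *v x)"
  shows "j \<le> level A x"
proof -
  have "x \<noteq> 0" using j by auto
  then show ?thesis using level_attained(2)[OF A, of x j] j by force
qed

text \<open>Going back \<open>m\<close> further steps gains a factor \<open>1 / \<delta>\<close>.
  Replacing the threshold 1 by \<open>\<delta>\<close> thus costs a number of levels uniform in
  \<open>x\<close>, hence only a constant factor in the quasi-norm.\<close>

lemma level_ge_of_norm_ge:
  assumes A: "expanding A" and \<delta>: "\<delta> > 0"
  obtains m :: nat where "\<And>x j. \<delta> \<le> norm (zpow A (- j) *v x) \<Longrightarrow> j \<le> level A x + int m"
proof -
  have inv: "invertible A" using A by (simp add: expanding_def)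
  obtain m :: nat where m: "\<And>x. norm (zpow A (- int m) *v x) \<le> \<delta> * norm x"
    using A \<delta> unfolding expanding_def by blast
  have "j \<le> level A x + int m" if j: "\<delta> \<le> norm (zpow A (- j) *v x)" for x j
  proof -
    have "norm (zpow A (- j) *v x) \<le> \<delta> * norm (zpow A (- (j - int m)) *v x)"
      using m[of "zpow A (- (j - int m)) *v x"] by (simp flip: zpow_shift[OF inv])
    then have "1 \<le> norm (zpow A (- (j - int m)) *v x)"
      using j \<delta> by (smt (verit) mult_less_cancel_left2)
    from level_ge[OF A this] show ?thesis by simp
  qed
  then show ?thesis using that by blast
qed

text \<open>Since the level is the largest exponent at which the norm reaches 1, a superlevel set
  with \<open>a \<ge> 0\<close> is a countable union of closed sets.\<close>

lemma level_norm_measurable: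
  fixes A :: "real^'n^'n"
  assumes A: "expanding A"
  shows "level_norm A \<in> borel_measurable borel"
proof -
  have d: "1 < \<bar>det A\<bar>" using A by (simp add: expanding_def)
  have "{x. a < level_norm A x} \<in> sets borel" for a
  proof (cases "a < 0")
    case True
    then have "{x. a < level_norm A x} = UNIV" using d by (auto simp: level_norm_def)
      (smt (verit) zero_less_power_int)
    then show ?thesis by simp
  next
    case False
    have "{x. a < level_norm A x}
        = (\<Union>i\<in>{i. a < \<bar>det A\<bar> powi i}. {x. 1 \<le> norm (zpow A (- i) *v x)})" (is "?L = ?R")
    proof (intro Set.set_eqI iffI)
      fix x assume x: "x \<in> ?L"
      then have "x \<noteq> 0" using False by (auto simp: level_norm_def)
      then show "x \<in> ?R" using x level_attained(1)[OF A, of x] by (auto simp: level_norm_def)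
    next
      fix x assume "x \<in> ?R"
      then obtain i where i: "a < \<bar>det A\<bar> powi i" "1 \<le> norm (zpow A (- i) *v x)" by auto
      then have "x \<noteq> 0" by auto
      moreover have "\<bar>det A\<bar> powi i \<le> \<bar>det A\<bar> powi level A x"
        using level_ge[OF A i(2)] d by (intro power_int_increasing) auto
      ultimately show "x \<in> ?L" using i by (auto simp: level_norm_def)
    qed
    moreover have "closed {x. 1 \<le> norm (zpow A (- i) *v x)}" for i
      by (intro closed_Collect_le continuous_intros)
    ultimately show ?thesis
      by (auto intro!: sets.countable_UN' borel_closed)
  qed
  then show ?thesis by (auto intro: borel_measurableI_greater)
qed

lemma quasi_norm_level_norm:
  fixes A :: "real^'n^'n"
  assumes A: "expanding A"
  shows "quasi_norm A (level_norm A)"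
proof -
  have inv: "invertible A" and d: "1 < \<bar>det A\<bar>" using A by (auto simp: expanding_def)
  have pos: "x \<noteq> 0 \<Longrightarrow> 0 < level_norm A x" for x using d by (simp add: level_norm_def)
  have nonneg: "0 \<le> level_norm A x" for x using pos[of x] by (cases "x = 0") (auto simp: level_norm_def)
  have hom: "level_norm A (A *v x) = \<bar>det A\<bar> * level_norm A x" for x
  proof (cases "x = 0")
    case False
    have shift: "zpow A j *v (A *v x) = zpow A (j + 1) *v x" for j
      using zpow_shift[OF inv, of j 1 x] zpow_Suc[OF inv, of 0] by simp
    have "level A (A *v x) = level A x + 1"
    proof (rule level_eqI)
      show "1 \<le> norm (zpow A (- (level A x + 1)) *v (A *v x))"
        using level_attained(1)[OF A False] by (simp add: shift)
      show "norm (zpow A (- i) *v (A *v x)) < 1" if "level A x + 1 < i" for i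
        using level_attained(2)[OF A False, of "i - 1"] that by (simp add: shift)
    qed
    moreover have "A *v x \<noteq> 0"
      using False inv by (metis matrix_inv_left matrix_vector_mul_assoc matrix_vector_mul_lid
          matrix_vector_mult_0_right)
    ultimately show ?thesis
      using False d by (simp add: level_norm_def power_int_add)
  qed (simp add: level_norm_def)
  \<comment> \<open>At the level of \<open>x + y\<close> one of the two pulled-back summands has
    norm at least 1/2; its own level is then at most \<open>m\<close> lower.\<close>
  have tri: "\<exists>c>0. \<forall>x y. level_norm A (x + y) \<le> c * (level_norm A x + level_norm A y)"
  proof -
    obtain m :: nat where m: "\<And>x j. 1 / 2 \<le> norm (zpow A (- j) *v x) \<Longrightarrow> j \<le> level A x + int m"
      using level_ge_of_norm_ge[OF A, of "1 / 2"] by auto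
    have half: "level_norm A z \<le> \<bar>det A\<bar> ^ m * level_norm A x"
      if z: "z \<noteq> 0" and x: "1 / 2 \<le> norm (zpow A (- level A z) *v x)" for x z
    proof -
      have "x \<noteq> 0" using x by auto
      have "\<bar>det A\<bar> powi level A z \<le> \<bar>det A\<bar> powi (level A x + int m)"
        using m[OF x] d by (intro power_int_increasing) auto
      then show ?thesis using z \<open>x \<noteq> 0\<close> d by (simp add: level_norm_def power_int_add mult.commute)
    qed
    have "level_norm A (x + y) \<le> \<bar>det A\<bar> ^ m * (level_norm A x + level_norm A y)" for x y
    proof (cases "x + y = 0")
      case False
      have "1 \<le> norm (zpow A (- level A (x + y)) *v x) + norm (zpow A (- level A (x + y)) *v y)"
        using level_attained(1)[OF A False]
        by (metis matrix_vector_right_distrib norm_triangle_ineq order_trans)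
      then consider "1 / 2 \<le> norm (zpow A (- level A (x + y)) *v x)"
        | "1 / 2 \<le> norm (zpow A (- level A (x + y)) *v y)" by linarith
      then show ?thesis
      proof cases
        case 1
        from half[OF False 1] show ?thesis
          using nonneg[of y] d by (smt (verit) distrib_left mult_nonneg_nonneg zero_le_power)
      next
        case 2
        from half[OF False 2] show ?thesis
          using nonneg[of x] d by (smt (verit) distrib_left mult_nonneg_nonneg zero_le_power)
      qed
    qed (use nonneg in \<open>auto simp: level_norm_def\<close>)
    then show ?thesis using d by (intro exI[of _ "\<bar>det A\<bar> ^ m"]) auto
  qed
  have "level_norm A \<in> borel_measurable lebesgue"
    using measurable_completion[of "level_norm A" lborel borel] level_norm_measurable[OF A] by simp
  then show ?thesis
    unfolding quasi_norm_def using nonneg pos hom tri by (auto simp: level_norm_def less_le)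
qed

lemma powi_eq_exp: "x > 0 \<Longrightarrow> x powi k = exp (real_of_int k * ln x)" for x :: real
  using powr_real_of_int'[of x k] by (simp add: powr_def)

text \<open>The hypothesis is applied at \<open>y = zpow A (- k) *v x\<close> with \<open>k\<close>
  the level of \<open>x\<close>, where \<open>norm y \<ge> 1\<close>; it keeps the
  \<open>B\<close>-orbit of \<open>S *v x\<close> above \<open>1 / K\<close> at a comparable
  exponent \<open>m\<close>.\<close>

lemma level_norm_le:
  fixes A B S :: "real^'n^'n"
  assumes A: "expanding A" and B: "expanding B" and K: "K > 0"
    and H: "\<And>k m y. \<bar>real_of_int k * ln \<bar>det A\<bar> - real_of_int m * ln \<bar>det B\<bar>\<bar> \<le> ln \<bar>det B\<bar>
      \<Longrightarrow> norm y \<le> K * norm (zpow B (- m) *v (S *v (zpow A k *v y)))"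
  obtains C where "C > 0" "\<And>x. level_norm A x \<le> C * level_norm B (S *v x)"
proof -
  let ?a = "\<bar>det A\<bar>" and ?b = "\<bar>det B\<bar>"
  have invA: "invertible A" and a: "1 < ?a" and b: "1 < ?b"
    using A B by (auto simp: expanding_def)
  obtain m0 :: nat where m0: "\<And>x j. 1 / K \<le> norm (zpow B (- j) *v x) \<Longrightarrow> j \<le> level B x + int m0"
    using level_ge_of_norm_ge[OF B, of "1 / K"] K by auto
  have "level_norm A x \<le> ?b ^ (m0 + 1) * level_norm B (S *v x)" for x
  proof (cases "x = 0")
    case False
    define k where "k = level A x"
    \<comment> \<open>Rounding down puts \<open>\<bar>det A\<bar> powi k\<close> between consecutive
      powers of \<open>\<bar>det B\<bar>\<close>. In the final exponent \<open>m0 + 1\<close>, the 1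
      pays for this rounding and \<open>m0\<close> for the threshold \<open>1 / K\<close>.\<close>
    define m where "m = \<lfloor>real_of_int k * ln ?a / ln ?b\<rfloor>"
    have lnb: "ln ?b > 0" using b by simp
    have m1: "real_of_int m * ln ?b \<le> real_of_int k * ln ?a"
      using lnb by (simp add: m_def flip: pos_le_divide_eq)
    have m2: "real_of_int k * ln ?a \<le> (real_of_int m + 1) * ln ?b"
      using lnb by (simp add: m_def flip: pos_divide_le_eq)
    have "1 \<le> norm (zpow A (- k) *v x)" using level_attained(1)[OF A False] by (simp add: k_def)
    also have "\<dots> \<le> K * norm (zpow B (- m) *v (S *v (zpow A k *v (zpow A (- k) *v x))))"
      using m1 m2 by (intro H) (simp add: algebra_simps abs_le_iff)
    also have "zpow A k *v (zpow A (- k) *v x) = x"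
      by (simp flip: zpow_shift[OF invA])
    finally have *: "1 / K \<le> norm (zpow B (- m) *v (S *v x))"
      using K by (simp add: field_simps)
    then have "S *v x \<noteq> 0" using K by auto
    have "?a powi k = exp (real_of_int k * ln ?a)"
      using a by (simp add: powi_eq_exp)
    also have "\<dots> \<le> exp (real_of_int (m + 1) * ln ?b)" using m2 by simp
    also have "\<dots> = ?b powi (m + 1)"
      using b by (simp add: powi_eq_exp)
    also have "\<dots> \<le> ?b powi (level B (S *v x) + int (m0 + 1))"
      using m0[OF *] b by (intro power_int_increasing) auto
    also have "\<dots> = ?b ^ (m0 + 1) * ?b powi level B (S *v x)"
      using b power_int_add[of ?b "level B (S *v x)" "int (m0 + 1)"]
      by (simp only: power_int_of_nat) (simp add: mult.commute)
    finally show ?thesis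
      using False \<open>S *v x \<noteq> 0\<close> by (simp add: level_norm_def k_def)
  qed (simp add: level_norm_def)
  then show ?thesis using that[of "?b ^ (m0 + 1)"] b by simp
qed

text \<open>The lower bound in \<open>H\<close> compares along \<open>S\<close>, the upper bound
  along its inverse. The rounding errors are measured by ln |det B| in one case and ln |det A| in
  the other, so \<open>M\<close> dominates both.\<close>

lemma linearly_equivalentI:
  fixes A B S :: "real^'n^'n"
  assumes A: "expanding A" and B: "expanding B" and S: "invertible S" and K: "K > 0"
    and M: "ln \<bar>det A\<bar> \<le> M" "ln \<bar>det B\<bar> \<le> M"
    and H: "\<And>k m y. \<bar>real_of_int k * ln \<bar>det A\<bar> - real_of_int m * ln \<bar>det B\<bar>\<bar> \<le> M
      \<Longrightarrow> norm y \<le> K * norm (zpow B (- m) *v (S *v (zpow A k *v y)))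
        \<and> norm (zpow B (- m) *v (S *v (zpow A k *v y))) \<le> K * norm y"
  shows "linearly_equivalent A B"
proof -
  have inv: "invertible A" "invertible B" using A B by (auto simp: expanding_def)
  let ?S' = "matrix_inv S"
  obtain C1 where C1: "C1 > 0" "\<And>x. level_norm A x \<le> C1 * level_norm B (S *v x)"
    by (rule level_norm_le[OF A B K, of S]) (use H M in force)+
  obtain C2 where C2: "C2 > 0" "\<And>x. level_norm B x \<le> C2 * level_norm A (?S' *v x)"
  proof (rule level_norm_le[OF B A K, of ?S'])
    fix k m y
    assume km: "\<bar>real_of_int k * ln \<bar>det B\<bar> - real_of_int m * ln \<bar>det A\<bar>\<bar> \<le> ln \<bar>det A\<bar>"
    \<comment> \<open>Chosen so that the matrix in \<open>H\<close> maps \<open>z\<close> to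
      \<open>y\<close>: the upper bound for \<open>z\<close> is then the required lower bound for
      \<open>y\<close>.\<close>
    define z where "z = zpow A (- m) *v (?S' *v (zpow B k *v y))"
    have "zpow B (- k) *v (S *v (zpow A m *v z)) = y"
      unfolding z_def zpow_shift[OF inv(1), symmetric]
      by (simp add: matrix_vector_mul_assoc matrix_inv_right[OF S] matrix_mul_assoc
          zpow_minus_left[OF inv(2)])
    moreover have "\<bar>real_of_int m * ln \<bar>det A\<bar> - real_of_int k * ln \<bar>det B\<bar>\<bar> \<le> M"
      using km M by linarith
    ultimately show "norm y \<le> K * norm (zpow A (- m) *v (?S' *v (zpow B k *v y)))"
      using H[of m k z] by (simp add: z_def)
  qed blast
  have C2': "level_norm B (S *v x) \<le> C2 * level_norm A x" for x
    using C2(2)[of "S *v x"] by (simp add: matrix_vector_mul_assoc matrix_inv_left[OF S])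
  define c where "c = max C1 C2"
  have nonneg: "0 \<le> level_norm A x" "0 \<le> level_norm B x" for x
    by (auto simp: level_norm_def)
  have "c > 0" using C1 by (simp add: c_def)
  moreover have "(1 / c) * level_norm A x \<le> level_norm B (S *v x)" for x
  proof -
    have "level_norm A x \<le> c * level_norm B (S *v x)"
      using C1(2)[of x] mult_right_mono[of C1 c "level_norm B (S *v x)"] nonneg
      by (simp add: c_def)
    then show ?thesis using \<open>c > 0\<close> by (simp add: field_simps)
  qed
  moreover have "level_norm B (S *v x) \<le> c * level_norm A x" for x
    using C2'[of x] mult_right_mono[of C2 c "level_norm A x"] nonneg by (simp add: c_def)
  ultimately show ?thesis
    unfolding linearly_equivalent_def
    using quasi_norm_level_norm[OF A] quasi_norm_level_norm[OF B] S by blast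
qed

section \<open>Entrywise bounds\<close>

text \<open>The entrywise l1 norm is submultiplicative over any normed field and does not change
  when a real matrix is read as a complex one.\<close>

definition entry_sum :: "'a::real_normed_vector^'n^'m \<Rightarrow> real" where
  "entry_sum A = (\<Sum>i\<in>UNIV. \<Sum>j\<in>UNIV. norm (A $ i $ j))"

lemma entry_sum_nonneg: "0 \<le> entry_sum A"
  by (simp add: entry_sum_def sum_nonneg)

lemma norm_entry_le: "norm (A $ i $ j) \<le> entry_sum A"
proof -
  have "norm (A $ i $ j) \<le> (\<Sum>j\<in>UNIV. norm (A $ i $ j))"
    by (rule member_le_sum) auto
  also have "\<dots> \<le> entry_sum A"
    unfolding entry_sum_def by (rule member_le_sum[where f = "\<lambda>i. \<Sum>j\<in>UNIV. norm (A $ i $ j)"])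
      (auto intro: sum_nonneg)
  finally show ?thesis .
qed

lemma entry_sum_le:
  fixes A :: "'a::real_normed_vector^'n^'m"
  assumes "\<And>i j. norm (A $ i $ j) \<le> c"
  shows "entry_sum A \<le> real CARD('m) * (real CARD('n) * c)"
proof -
  have "(\<Sum>j\<in>UNIV. norm (A $ i $ j)) \<le> real CARD('n) * c" for i
    using sum_bounded_above[of UNIV "\<lambda>j. norm (A $ i $ j)" c] assms by simp
  then show ?thesis
    unfolding entry_sum_def
    using sum_bounded_above[of UNIV "\<lambda>i. \<Sum>j\<in>UNIV. norm (A $ i $ j)" "real CARD('n) * c"] by simp
qed

lemma entry_sum_mult:
  fixes A :: "'a::real_normed_field^'n^'m" and B :: "'a^'p^'n"
  shows "entry_sum (A ** B) \<le> entry_sum A * entry_sum B"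
proof -
  have row: "(\<Sum>j\<in>UNIV. norm (B $ k $ j)) \<le> entry_sum B" for k
    unfolding entry_sum_def by (rule member_le_sum[where f = "\<lambda>k. \<Sum>j\<in>UNIV. norm (B $ k $ j)"])
      (auto intro: sum_nonneg)
  have "entry_sum (A ** B) \<le> (\<Sum>i\<in>UNIV. \<Sum>j\<in>UNIV. \<Sum>k\<in>UNIV. norm (A $ i $ k) * norm (B $ k $ j))"
    unfolding entry_sum_def matrix_matrix_mult_def
    by (auto intro!: sum_mono sum_norm_le simp: norm_mult)
  also have "\<dots> = (\<Sum>i\<in>UNIV. \<Sum>k\<in>UNIV. \<Sum>j\<in>UNIV. norm (A $ i $ k) * norm (B $ k $ j))"
    by (intro sum.cong refl sum.swap)
  also have "\<dots> = (\<Sum>i\<in>UNIV. \<Sum>k\<in>UNIV. norm (A $ i $ k) * (\<Sum>j\<in>UNIV. norm (B $ k $ j)))"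
    by (simp add: sum_distrib_left)
  also have "\<dots> \<le> (\<Sum>i\<in>UNIV. \<Sum>k\<in>UNIV. norm (A $ i $ k) * entry_sum B)"
    by (intro sum_mono mult_left_mono row) auto
  also have "\<dots> = entry_sum A * entry_sum B"
    by (simp add: entry_sum_def sum_distrib_right)
  finally show ?thesis .
qed

lemma entry_sum_mult3:
  fixes P X Q :: "'a::real_normed_field^'n^'n"
  shows "entry_sum (P ** X ** Q) \<le> entry_sum P * entry_sum X * entry_sum Q"
  by (meson entry_sum_mult entry_sum_nonneg mult_right_mono order_trans)

lemma norm_matrix_vector_le:
  fixes A :: "real^'n^'m"
  shows "norm (A *v x) \<le> entry_sum A * norm x"
proof -
  have "norm (A *v x) \<le> (\<Sum>i\<in>UNIV. \<bar>(A *v x) $ i\<bar>)"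
    by (rule norm_le_l1_cart)
  also have "\<dots> \<le> (\<Sum>i\<in>UNIV. \<Sum>j\<in>UNIV. \<bar>A $ i $ j\<bar> * norm x)"
    unfolding matrix_vector_mult_def
    by (auto intro!: sum_mono order_trans[OF sum_abs] mult_left_mono component_le_norm_cart simp: abs_mult)
  also have "\<dots> = entry_sum A * norm x"
    by (simp add: entry_sum_def sum_distrib_right)
  finally show ?thesis .
qed

lemma det_le:
  fixes T :: "real^'n^'n"
  assumes "\<And>i j. \<bar>T $ i $ j\<bar> \<le> c"
  shows "\<bar>det T\<bar> \<le> fact CARD('n) * c ^ CARD('n)"
proof -
  have "\<bar>\<Prod>i\<in>UNIV. T $ i $ p i\<bar> \<le> c ^ CARD('n)" for p :: "'n \<Rightarrow> 'n"
    unfolding abs_prod using prod_mono[of UNIV "\<lambda>i. \<bar>T $ i $ p i\<bar>" "\<lambda>_. c"] assms by simp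
  then have "\<bar>of_int (sign p) * (\<Prod>i\<in>UNIV. T $ i $ p i)\<bar> \<le> c ^ CARD('n)" for p :: "'n \<Rightarrow> 'n"
    by (simp add: abs_mult sign_def)
  then have "\<bar>det T\<bar> \<le> (\<Sum>p | p permutes (UNIV :: 'n set). c ^ CARD('n))"
    unfolding det_def by (intro order_trans[OF sum_abs] sum_mono)
  also have "\<dots> = fact CARD('n) * c ^ CARD('n)"
    by (simp add: card_permutations)
  finally show ?thesis .
qed

text \<open>By Cramer's rule, bounded entries and a determinant away from 0 bound the inverse.
  Scaling \<open>T *v y\<close> to norm 1 lets it replace a column without exceeding the entry
  bound, whence \<open>1 \<le> c\<close>.\<close>

lemma norm_le_of_det_ge:
  fixes T :: "real^'n^'n"
  assumes c: "\<And>i j. \<bar>T $ i $ j\<bar> \<le> c" "1 \<le> c" and \<delta>: "0 < \<delta>" "\<delta> \<le> \<bar>det T\<bar>"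
  shows "norm y \<le> real CARD('n) * (fact CARD('n) * c ^ CARD('n) / \<delta>) * norm (T *v y)"
proof (cases "T *v y = 0")
  case True
  have "invertible T" using \<delta> by (auto simp: invertible_det_nz)
  then have "y = 0" using True
    by (metis matrix_inv_left matrix_vector_mul_assoc matrix_vector_mul_lid matrix_vector_mult_0_right)
  then show ?thesis by simp
next
  case False
  define r where "r = norm (T *v y)"
  have r: "r > 0" using False by (simp add: r_def)
  define z where "z = (1 / r) *\<^sub>R y"
  have Tz: "T *v z = (1 / r) *\<^sub>R (T *v y)"
    by (simp add: z_def matrix_vector_mult_scaleR)
  have b: "\<bar>(T *v z) $ i\<bar> \<le> c" for i
  proof -
    have "\<bar>(T *v z) $ i\<bar> \<le> norm (T *v z)" by (rule component_le_norm_cart)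
    also have "\<dots> = 1" using r by (simp add: Tz r_def)
    finally show ?thesis using c(2) by linarith
  qed
  have "z = (\<chi> k. det (\<chi> i j. if j = k then (T *v z) $ i else T $ i $ j) / det T)"
    using cramer[of T z "T *v z"] \<delta> by simp
  then have zk: "z $ k = det (\<chi> i j. if j = k then (T *v z) $ i else T $ i $ j) / det T" for k
    by (rule trans[OF arg_cong[where f = "\<lambda>v. v $ k"]]) simp
  have "\<bar>z $ k\<bar> \<le> fact CARD('n) * c ^ CARD('n) / \<delta>" for k
  proof -
    have "\<bar>det (\<chi> i j. if j = k then (T *v z) $ i else T $ i $ j)\<bar> \<le> fact CARD('n) * c ^ CARD('n)"
      using b c by (intro det_le) simp
    then show ?thesis
      unfolding zk abs_divide using \<delta> by (intro frac_le) auto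
  qed
  then have "norm z \<le> real CARD('n) * (fact CARD('n) * c ^ CARD('n) / \<delta>)"
    using norm_le_l1_cart[of z]
      sum_bounded_above[of UNIV "\<lambda>k. \<bar>z $ k\<bar>" "fact CARD('n) * c ^ CARD('n) / \<delta>"] by simp
  then show ?thesis using r by (simp add: z_def r_def field_simps)
qed

text \<open>The polynomial \<open>p\<close> has the value \<open>det S\<close> at the imaginary
  unit, so it is not zero, and its finitely many roots cannot exhaust the real line.\<close>

lemma real_combination_invertible:
  fixes S :: "complex^'n^'n"
  assumes "invertible S"
  obtains z where "invertible (\<chi> i j. Re (S $ i $ j) + z * Im (S $ i $ j))"
proof -
  define p where "p = (\<Sum>\<pi> | \<pi> permutes (UNIV :: 'n set).
    [:of_int (sign \<pi>):] * (\<Prod>i\<in>UNIV. [:complex_of_real (Re (S $ i $ \<pi> i)), complex_of_real (Im (S $ i $ \<pi> i)):]))"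
  have p: "poly p w = det (\<chi> i j. complex_of_real (Re (S $ i $ j)) + w * complex_of_real (Im (S $ i $ j)))" for w
    unfolding p_def det_def by (simp add: poly_sum poly_prod)
  have "(\<chi> i j. complex_of_real (Re (S $ i $ j)) + \<i> * complex_of_real (Im (S $ i $ j))) = S"
    by (simp add: vec_eq_iff complex_eq_iff)
  then have "poly p \<i> \<noteq> 0" using assms by (simp add: p invertible_det_nz)
  then have "finite {w. poly p w = 0}" by (intro poly_roots_finite) auto
  moreover have "infinite (range complex_of_real)"
    using infinite_UNIV_char_0 by (metis finite_imageD inj_of_real)
  ultimately have "\<not> range complex_of_real \<subseteq> {w. poly p w = 0}"
    using finite_subset by blast
  then obtain z where "poly p (complex_of_real z) \<noteq> 0" by auto
  moreover have "(\<chi> i j. complex_of_real (Re (S $ i $ j)) + complex_of_real z * complex_of_real (Im (S $ i $ j)))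
      = map_matrix complex_of_real (\<chi> i j. Re (S $ i $ j) + z * Im (S $ i $ j))"
    by (simp add: vec_eq_iff)
  ultimately have "complex_of_real (det (\<chi> i j. Re (S $ i $ j) + z * Im (S $ i $ j))) \<noteq> 0"
    by (simp only: p det_map_matrix_of_real simp_thms)
  then have "det (\<chi> i j. Re (S $ i $ j) + z * Im (S $ i $ j)) \<noteq> 0"
    by (simp only: of_real_eq_0_iff simp_thms)
  then show ?thesis using that by (simp add: invertible_det_nz)
qed

section \<open>Matrices in Jordan form\<close>

definition jordan_form :: "real^'n^'n \<Rightarrow> ('n::finite \<Rightarrow> nat \<times> nat) \<Rightarrow> nat \<Rightarrow> (nat \<Rightarrow> nat) \<Rightarrow>
    (nat \<Rightarrow> complex) \<Rightarrow> complex^'n^'n \<Rightarrow> bool" where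
  "jordan_form A \<beta> K s \<mu> P \<longleftrightarrow> block_coords \<beta> K s \<and> (\<forall>b<K. 0 < s b) \<and> invertible P \<and>
     map_matrix complex_of_real A ** P = P ** jordan_toeplitz \<beta> \<mu>"

lemma power_times_geometric_tendsto_0:
  fixes r :: real
  assumes "0 < r" "r < 1"
  shows "(\<lambda>n. real n ^ d * r ^ n) \<longlonglongrightarrow> 0"
proof -
  define L where "L = - ln r"
  have L: "L > 0" using assms by (simp add: L_def)
  have "filterlim (\<lambda>n. real n * L) at_top sequentially"
    using L by real_asymp
  from filterlim_compose[OF tendsto_power_div_exp_0[of d] this]
  have "(\<lambda>n. (1 / L ^ d) * ((real n * L) ^ d / exp (real n * L))) \<longlonglongrightarrow> (1 / L ^ d) * 0"
    by (intro tendsto_mult tendsto_const)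
  moreover have "(1 / L ^ d) * ((real n * L) ^ d / exp (real n * L)) = real n ^ d * r ^ n" for n
  proof -
    have "exp (real n * L) = inverse (r ^ n)"
      using assms exp_of_nat_mult[of n L] by (simp add: L_def exp_minus power_inverse)
    then show ?thesis using L by (simp add: power_mult_distrib divide_inverse)
  qed
  ultimately show ?thesis by simp
qed

lemma jordan_form_det:
  assumes J: "jordan_form A \<beta> K s \<mu> P"
  shows "complex_of_real (det A) = (\<Prod>i\<in>UNIV. \<mu> (fst (\<beta> i)))"
  using J det_eq_of_intertwine[of P "map_matrix complex_of_real A" "jordan_toeplitz \<beta> \<mu>"]
    det_jordan_toeplitz[of \<beta> K s \<mu>]
  by (simp add: jordan_form_def det_map_matrix_of_real)

lemma jordan_form_abs_det:
  assumes J: "jordan_form A \<beta> K s \<mu> P"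
  shows "\<bar>det A\<bar> = (\<Prod>i\<in>UNIV. cmod (\<mu> (fst (\<beta> i))))"
  using arg_cong[OF jordan_form_det[OF J], of cmod] by (simp add: prod_norm)

lemma jordan_form_flow:
  fixes A :: "real^'n^'n"
  assumes J: "jordan_form A \<beta> K s \<mu> P" and \<mu>: "\<And>b. b < K \<Longrightarrow> \<mu> b \<noteq> 0" and c: "c \<noteq> 0"
  obtains Q where "invertible Q"
    "\<And>k. map_matrix complex_of_real (zpow A k)
       = Q ** toeplitz \<beta> \<beta> (\<lambda>b. exp_series (\<mu> b powi k) (of_int k * c)) ** matrix_inv Q"
proof -
  have \<beta>: "block_coords \<beta> K s" and P: "invertible P"
    and AP: "map_matrix complex_of_real A ** P = P ** jordan_toeplitz \<beta> \<mu>"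
    using J by (auto simp: jordan_form_def)
  have "det A \<noteq> 0"
    using jordan_form_det[OF J] \<mu> block_coords_less(1)[OF \<beta>] by (metis (no_types, lifting) of_real_0 finite prod_zero_iff)
  then have A: "invertible A" by (simp add: invertible_det_nz)
  obtain C where C: "invertible C" "\<And>k. zpow (jordan_toeplitz \<beta> \<mu>) k ** C
       = C ** toeplitz \<beta> \<beta> (\<lambda>b. exp_series (\<mu> b powi k) (of_int k * c))"
    using zpow_jordan_toeplitz[OF \<beta>, of \<mu> c] \<mu> c by metis
  have Q: "invertible (P ** C)" using P C(1) by (rule invertible_mult)
  have eq: "map_matrix complex_of_real (zpow A k)
       = (P ** C) ** toeplitz \<beta> \<beta> (\<lambda>b. exp_series (\<mu> b powi k) (of_int k * c)) ** matrix_inv (P ** C)" for k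
  proof -
    have "map_matrix complex_of_real (zpow A k) ** (P ** C) = P ** zpow (jordan_toeplitz \<beta> \<mu>) k ** C"
      using zpow_intertwine[OF invertible_of_real[OF A] invertible_jordan_toeplitz[OF \<beta> \<mu>] AP, of k]
      by (simp add: map_matrix_zpow[OF A] matrix_mul_assoc)
    also have "\<dots> = (P ** C) ** toeplitz \<beta> \<beta> (\<lambda>b. exp_series (\<mu> b powi k) (of_int k * c))"
      by (simp add: C(2) flip: matrix_mul_assoc)
    finally have "map_matrix complex_of_real (zpow A k) ** ((P ** C) ** matrix_inv (P ** C))
        = (P ** C) ** toeplitz \<beta> \<beta> (\<lambda>b. exp_series (\<mu> b powi k) (of_int k * c)) ** matrix_inv (P ** C)"
      by (simp only: matrix_mul_assoc)
    then show ?thesis by (simp add: matrix_inv_right[OF Q])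
  qed
  show ?thesis by (rule that[OF Q eq])
qed

lemma entry_sum_map_matrix: "entry_sum (map_matrix complex_of_real A) = entry_sum A"
  by (simp add: entry_sum_def)

text \<open>In flow form the entries of the power \<open>- k\<close> are a geometrically decaying
  factor times a power of \<open>k\<close>; the change of basis costs only a constant.\<close>

lemma jordan_form_expanding:
  fixes A :: "real^'n^'n"
  assumes J: "jordan_form A \<beta> K s \<mu> P" and \<mu>: "\<And>b. b < K \<Longrightarrow> 1 < cmod (\<mu> b)"
  shows "expanding A"
proof -
  have \<beta>: "block_coords \<beta> K s" using J by (auto simp: jordan_form_def)
  note less = block_coords_less[OF \<beta>]
  have \<mu>0: "\<mu> b \<noteq> 0" if "b < K" for b using \<mu>[OF that] by auto
  have d: "1 < \<bar>det A\<bar>"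
    unfolding jordan_form_abs_det[OF J]
    by (rule less_1_prod) (use \<mu> less in auto)
  then have A: "invertible A" by (auto simp: invertible_det_nz)
  obtain Q where Q: "\<And>k. map_matrix complex_of_real (zpow A k)
       = Q ** toeplitz \<beta> \<beta> (\<lambda>b. exp_series (\<mu> b powi k) (of_int k * 1)) ** matrix_inv Q"
    using jordan_form_flow[OF J \<mu>0, of 1] by (metis zero_neq_one)
  define T where "T = (\<lambda>k::nat. toeplitz \<beta> \<beta> (\<lambda>b. exp_series (\<mu> b powi (- int k)) (of_int (- int k) * 1)))"
  have "(\<lambda>k. entry_sum (T k)) \<longlonglongrightarrow> 0"
    unfolding entry_sum_def
  proof (intro tendsto_null_sum)
    fix i j
    define b where "b = fst (\<beta> j)"
    define d where "d = snd (\<beta> j) - snd (\<beta> i)"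
    have b: "b < K" using less(1) by (simp add: b_def)
    have eq: "cmod (\<mu> b powi (- int k) * of_int (- int k) ^ d / fact d)
        = (1 / fact d) * (real k ^ d * (1 / cmod (\<mu> b)) ^ k)" for k
      by (simp add: norm_mult norm_divide norm_power power_int_minus norm_inverse power_divide field_simps)
    have "(\<lambda>k. (1 / fact d) * (real k ^ d * (1 / cmod (\<mu> b)) ^ k)) \<longlonglongrightarrow> (1 / fact d) * 0"
      using \<mu>[OF b] by (intro tendsto_mult tendsto_const power_times_geometric_tendsto_0)
        (auto simp: divide_simps)
    then have "(\<lambda>k. cmod (\<mu> b powi (- int k) * of_int (- int k) ^ d / fact d)) \<longlonglongrightarrow> 0"
      unfolding eq by simp
    then show "(\<lambda>k. norm (T k $ i $ j)) \<longlonglongrightarrow> 0"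
      by (cases "fst (\<beta> i) = fst (\<beta> j) \<and> snd (\<beta> i) \<le> snd (\<beta> j)")
        (auto simp: T_def toeplitz_def fps_nth_exp_series b_def d_def)
  qed
  then have lim: "(\<lambda>k. entry_sum Q * entry_sum (T k) * entry_sum (matrix_inv Q)) \<longlonglongrightarrow> 0"
    by (intro tendsto_mult_left_zero tendsto_mult_right_zero)
  have le: "entry_sum (zpow A (- int k)) \<le> entry_sum Q * entry_sum (T k) * entry_sum (matrix_inv Q)" for k
    using entry_sum_mult3[of Q "T k" "matrix_inv Q"] unfolding T_def Q[symmetric]
    by (simp add: entry_sum_map_matrix)
  have "\<exists>m::nat. \<forall>k\<ge>m. \<forall>x. norm (zpow A (- int k) *v x) \<le> \<epsilon> * norm x" if eps: "\<epsilon> > 0" for \<epsilon>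
  proof -
    obtain m where m: "\<forall>k\<ge>m. entry_sum Q * entry_sum (T k) * entry_sum (matrix_inv Q) < \<epsilon>"
      using order_tendstoD(2)[OF lim eps] by (auto simp: eventually_sequentially)
    have "norm (zpow A (- int k) *v x) \<le> \<epsilon> * norm x" if "k \<ge> m" for k x
      using norm_matrix_vector_le[of "zpow A (- int k)" x] le[of k] m[rule_format, OF that]
      by (smt (verit) mult_right_mono norm_ge_zero)
    then show ?thesis by blast
  qed
  then show ?thesis unfolding expanding_def using A d by blast
qed

lemma expansive_eigenvalue:
  fixes A :: "real^'n^'n"
  assumes J: "jordan_form A \<beta> K s \<mu> P" and A: "expansive_dilation A" and b: "b < K"
  shows "1 < cmod (\<mu> b)"
proof -
  have \<beta>: "block_coords \<beta> K s" and s: "0 < s b" and P: "invertible P"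
    and AP: "map_matrix complex_of_real A ** P = P ** jordan_toeplitz \<beta> \<mu>"
    using J b by (auto simp: jordan_form_def)
  \<comment> \<open>The ones stand above the diagonal, so position 0 of a nonempty block is an
    eigenvector.\<close>
  have "(b, 0) \<in> (SIGMA b:{..<K}. {..<s b})" using b s by auto
  then obtain i where i: "\<beta> i = (b, 0)"
    using \<beta> unfolding block_coords_def bij_betw_def by (metis imageE)
  define v where "v = P *v axis i 1"
  have "jordan_toeplitz \<beta> \<mu> $ k $ i = (if k = i then \<mu> b else 0)" for k
    using block_coords_inj[OF \<beta>, of k i] i by (cases "k = i") (auto simp: toeplitz_def prod_eq_iff)
  then have "jordan_toeplitz \<beta> \<mu> *v axis i 1 = \<mu> b *s axis i 1"
    by (simp add: vec_eq_iff matrix_vector_mult_def axis_def mult_delta_right)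
  moreover have "map_matrix complex_of_real A *v v = P *v (jordan_toeplitz \<beta> \<mu> *v axis i 1)"
    unfolding v_def matrix_vector_mul_assoc AP ..
  ultimately have "map_matrix complex_of_real A *v v = \<mu> b *s v"
    by (simp add: v_def vector_scalar_commute)
  moreover have "v \<noteq> 0"
  proof
    assume "v = 0"
    then have "matrix_inv P *v (P *v axis i 1) = 0" by (simp add: v_def)
    then have "axis i (1::complex) = 0"
      by (simp add: matrix_vector_mul_assoc matrix_inv_left[OF P])
    then show False by simp
  qed
  ultimately show ?thesis
    using A unfolding expansive_dilation_def complex_eigenvalue_def by blast
qed

lemma map_matrix_jordan_toeplitz:
  "map_matrix complex_of_real (jordan_toeplitz \<beta> \<nu>) = jordan_toeplitz \<beta> (\<lambda>b. complex_of_real (\<nu> b))"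
  by (auto simp: vec_eq_iff toeplitz_def fps_X_def)

lemma jordan_form_real:
  assumes "block_coords \<beta> K s" "\<And>b. b < K \<Longrightarrow> 0 < s b"
  shows "jordan_form (jordan_toeplitz \<beta> \<nu>) \<beta> K s (\<lambda>b. complex_of_real (\<nu> b)) (mat 1)"
  using assms by (simp add: jordan_form_def map_matrix_jordan_toeplitz invertible_det_nz)

text \<open>Subtracting an eigenvalue from the diagonal leaves a Jordan matrix, whose singularity
  forces one of its diagonal values to be 0.\<close>

lemma expansive_dilation_jordan_toeplitz:
  fixes \<beta> :: "'n::finite \<Rightarrow> nat \<times> nat"
  assumes \<beta>: "block_coords \<beta> K s" and \<nu>: "\<And>b. b < K \<Longrightarrow> 1 < \<nu> b"
  shows "expansive_dilation (jordan_toeplitz \<beta> \<nu> :: real^'n^'n)"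
  unfolding expansive_dilation_def
proof (intro allI impI)
  fix \<mu> assume "complex_eigenvalue (jordan_toeplitz \<beta> \<nu> :: real^'n^'n) \<mu>"
  then obtain v :: "complex^'n" where v: "v \<noteq> 0" "jordan_toeplitz \<beta> (\<lambda>b. complex_of_real (\<nu> b)) *v v = \<mu> *s v"
    unfolding complex_eigenvalue_def map_matrix_jordan_toeplitz by blast
  let ?M = "jordan_toeplitz \<beta> (\<lambda>b. complex_of_real (\<nu> b) - \<mu>)"
  have entry: "?M $ i $ j = jordan_toeplitz \<beta> (\<lambda>b. complex_of_real (\<nu> b)) $ i $ j - (if i = j then \<mu> else 0)" for i j
    using block_coords_inj[OF \<beta>, of i j] by (auto simp: toeplitz_def prod_eq_iff)
  have "?M $ i $ j * v $ j = jordan_toeplitz \<beta> (\<lambda>b. complex_of_real (\<nu> b)) $ i $ j * v $ j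
      - (if i = j then \<mu> * v $ j else 0)" for i j
    unfolding entry by (simp add: left_diff_distrib)
  then have "?M *v v = jordan_toeplitz \<beta> (\<lambda>b. complex_of_real (\<nu> b)) *v v - \<mu> *s v"
    by (simp add: vec_eq_iff matrix_vector_mult_def sum_subtractf)
  then have "?M *v v = 0" using v(2) by simp
  then have "\<not> invertible ?M"
    using v(1) by (metis matrix_inv_left matrix_vector_mul_assoc matrix_vector_mul_lid matrix_vector_mult_0_right)
  then obtain b where "b < K" "complex_of_real (\<nu> b) = \<mu>"
    using invertible_jordan_toeplitz[OF \<beta>, of "\<lambda>b. complex_of_real (\<nu> b) - \<mu>"] by auto
  then show "1 < cmod \<mu>" using \<nu>[of b] by auto
qed

section \<open>Equivalence of a dilation with its real Jordan model\<close>

text \<open>Real factors act separately on real and imaginary parts. This carries entry bounds from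
  the complex intertwining over to the real one.\<close>

lemma real_combination_mult:
  fixes X Y :: "real^'n^'n" and S :: "complex^'n^'n"
  shows "(X ** (\<chi> i j. Re (S $ i $ j) + z * Im (S $ i $ j)) ** Y) $ i $ j
    = Re ((map_matrix complex_of_real X ** S ** map_matrix complex_of_real Y) $ i $ j)
      + z * Im ((map_matrix complex_of_real X ** S ** map_matrix complex_of_real Y) $ i $ j)"
  by (simp add: matrix_matrix_mult_def sum_distrib_left sum_distrib_right sum.distrib
      distrib_left distrib_right mult_ac)

lemma linearly_equivalent_jordan_forms:
  fixes A B :: "real^'n^'n"
  assumes JA: "jordan_form A \<beta> K s \<mu> P" and \<mu>: "\<And>b. b < K \<Longrightarrow> 1 < cmod (\<mu> b)"
    and JB: "jordan_form B \<gamma> K s (\<lambda>b. complex_of_real (cmod (\<mu> b) powr t)) P'" and t: "t > 0"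
  shows "linearly_equivalent A B"
proof -
  define \<nu> where "\<nu> b = cmod (\<mu> b) powr t" for b
  define a where "a = ln \<bar>det A\<bar>"
  define M where "M = max a (t * a)"
  \<comment> \<open>The closeness condition on \<open>k\<close> and \<open>m\<close> reads
    \<open>\<bar>k - m * t\<bar> * a \<le> M\<close>, so \<open>R\<close> bounds the flow time
    \<open>k - m * t\<close>.\<close>
  define R where "R = M / a"
  have \<beta>: "block_coords \<beta> K s" and \<gamma>: "block_coords \<gamma> K s"
    using JA JB by (auto simp: jordan_form_def)
  have \<mu>0: "\<mu> b \<noteq> 0" if "b < K" for b using \<mu>[OF that] by auto
  have \<nu>1: "1 < \<nu> b" if "b < K" for b
    using \<mu>[OF that] t by (simp add: \<nu>_def)
  have \<nu>0: "complex_of_real (\<nu> b) \<noteq> 0" if "b < K" for b using \<nu>1[OF that] by simp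
  note JB' = JB[folded \<nu>_def]
  have expA: "expanding A" by (rule jordan_form_expanding[OF JA \<mu>])
  have expB: "expanding B" by (rule jordan_form_expanding[OF JB']) (use \<nu>1 in fastforce)
  have invA: "invertible A" and invB: "invertible B" and detA: "1 < \<bar>det A\<bar>" and detB: "1 < \<bar>det B\<bar>"
    using expA expB by (auto simp: expanding_def)
  have a: "a > 0" using detA by (simp add: a_def)
  have prodA: "\<bar>det A\<bar> = (\<Prod>b<K. \<Prod>l<s b. cmod (\<mu> b))"
    unfolding jordan_form_abs_det[OF JA] using prod_block_coords[OF \<beta>, of "\<lambda>x. cmod (\<mu> (fst x))"] by simp
  have prodB: "\<bar>det B\<bar> = (\<Prod>b<K. \<Prod>l<s b. \<nu> b)"
    unfolding jordan_form_abs_det[OF JB']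
    using prod_block_coords[OF \<gamma>, of "\<lambda>x. \<bar>\<nu> (fst x)\<bar>"] by (simp add: \<nu>_def)
  have "(cmod (\<mu> b) powr t) ^ n = (cmod (\<mu> b) ^ n) powr t" for b n
    by (induction n) (simp_all add: powr_mult)
  then have "\<bar>det B\<bar> = \<bar>det A\<bar> powr t"
    unfolding prodA prodB \<nu>_def by (simp add: prod_powr_distrib)
  then have lnB: "ln \<bar>det B\<bar> = t * a" using detA by (simp add: a_def ln_powr)
  have R: "R \<ge> 0" using a by (simp add: R_def M_def)
  obtain QA where QA: "invertible QA" "\<And>k. map_matrix complex_of_real (zpow A k)
       = QA ** toeplitz \<beta> \<beta> (\<lambda>b. exp_series (\<mu> b powi k) (of_int k * 1)) ** matrix_inv QA"
    using jordan_form_flow[OF JA \<mu>0, of 1] by (metis zero_neq_one)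
  obtain QB where QB: "invertible QB" "\<And>k. map_matrix complex_of_real (zpow B k)
       = QB ** toeplitz \<gamma> \<gamma> (\<lambda>b. exp_series (complex_of_real (\<nu> b) powi k) (of_int k * of_real t)) ** matrix_inv QB"
    using jordan_form_flow[OF JB' \<nu>0, of "of_real t"] t by auto
  \<comment> \<open>In flow coordinates \<open>S\<close> identifies block \<open>b\<close> of
    \<open>A\<close> with block \<open>b\<close> of \<open>B\<close>; the two flows then act on the
    same blocks and combine into \<open>E\<close>.\<close>
  define S where "S = QB ** toeplitz \<gamma> \<beta> (\<lambda>_. 1) ** matrix_inv QA"
  have invS: "invertible S"
    unfolding S_def using QA(1) QB(1) invertible_toeplitz_one[OF \<gamma> \<beta>]
    by (intro invertible_mult invertible_matrix_inv)
  define W where "W k m = map_matrix complex_of_real (zpow B (- m)) ** S ** map_matrix complex_of_real (zpow A k)" for k m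
  define E where "E k m = toeplitz \<gamma> \<beta> (\<lambda>b. exp_series (complex_of_real (\<nu> b) powi (- m) * \<mu> b powi k)
      (complex_of_real (of_int k - of_int m * t)))" for k m
  have W: "W k m = QB ** E k m ** matrix_inv QA" for k m
  proof -
    define TA where "TA = toeplitz \<beta> \<beta> (\<lambda>b. exp_series (\<mu> b powi k) (of_int k * 1))"
    define TB where "TB = toeplitz \<gamma> \<gamma> (\<lambda>b. exp_series (complex_of_real (\<nu> b) powi (- m)) (of_int (- m) * of_real t))"
    have "W k m = QB ** TB ** (matrix_inv QB ** QB) ** toeplitz \<gamma> \<beta> (\<lambda>_. 1) ** (matrix_inv QA ** QA) ** TA ** matrix_inv QA"
      unfolding W_def QA(2) QB(2) S_def TA_def TB_def by (simp only: matrix_mul_assoc)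
    also have "\<dots> = QB ** (TB ** toeplitz \<gamma> \<beta> (\<lambda>_. 1) ** TA) ** matrix_inv QA"
      by (simp only: matrix_inv_left[OF QA(1)] matrix_inv_left[OF QB(1)] matrix_mul_rid matrix_mul_assoc)
    also have "TB ** toeplitz \<gamma> \<beta> (\<lambda>_. 1) ** TA = E k m"
      unfolding TB_def TA_def E_def toeplitz_mult[OF \<gamma> \<beta>] toeplitz_mult[OF \<beta> \<beta>]
      by (simp add: exp_series_mult)
    finally show ?thesis .
  qed
  \<comment> \<open>Summing over all blocks and offsets gives one bound valid for every
    entry.\<close>
  define c where "c = (\<Sum>x\<in>(SIGMA b:{..<K}. {..<s b}). exp (R * ln (cmod (\<mu> (fst x)))) * R ^ snd x)"
  have Ebound: "cmod (E k m $ i $ j) \<le> c" if km: "\<bar>of_int k * a - of_int m * (t * a)\<bar> \<le> M" for k m i j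
  proof (cases "fst (\<gamma> i) = fst (\<beta> j) \<and> snd (\<gamma> i) \<le> snd (\<beta> j)")
    case True
    define b where "b = fst (\<beta> j)"
    define d where "d = snd (\<beta> j) - snd (\<gamma> i)"
    define u where "u = of_int k - of_int m * t"
    have b: "b < K" "d < s b" using block_coords_less[OF \<beta>, of j] by (auto simp: b_def d_def)
    have "of_int k * a - of_int m * (t * a) = u * a" by (simp add: u_def algebra_simps)
    then have "\<bar>u\<bar> * a = \<bar>of_int k * a - of_int m * (t * a)\<bar>"
      using a by (simp add: abs_mult)
    then have u: "\<bar>u\<bar> \<le> R" using km a by (simp add: R_def pos_le_divide_eq)
    have ln: "ln (cmod (\<mu> b)) > 0" using \<mu>[OF b(1)] by (rule ln_gt_zero)
    have "cmod (complex_of_real (\<nu> b) powi (- m) * \<mu> b powi k) = \<nu> b powi (- m) * cmod (\<mu> b) powi k"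
      using \<nu>1[OF b(1)] by (simp add: norm_mult norm_power_int)
    also have "\<dots> = exp (u * ln (cmod (\<mu> b)))"
      using \<nu>1[OF b(1)] \<mu>0[OF b(1)]
      by (simp add: powi_eq_exp \<nu>_def u_def ln_powr algebra_simps flip: exp_add)
    also have "\<dots> \<le> exp (R * ln (cmod (\<mu> b)))"
      using u ln by (simp add: abs_le_iff)
    finally have 1: "cmod (complex_of_real (\<nu> b) powi (- m) * \<mu> b powi k) \<le> exp (R * ln (cmod (\<mu> b)))" .
    have 2: "cmod (complex_of_real u) ^ d / fact d \<le> R ^ d"
    proof -
      have "cmod (complex_of_real u) ^ d / fact d \<le> \<bar>u\<bar> ^ d / 1"
        by (intro frac_le) (auto simp: fact_ge_1)
      also have "\<dots> \<le> R ^ d" using u by (simp add: power_mono)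
      finally show ?thesis .
    qed
    have "cmod (E k m $ i $ j)
        = cmod (complex_of_real (\<nu> b) powi (- m) * \<mu> b powi k) * (cmod (complex_of_real u) ^ d / fact d)"
      using True by (simp add: E_def toeplitz_def fps_nth_exp_series b_def d_def u_def norm_mult norm_divide norm_power)
    also have "\<dots> \<le> exp (R * ln (cmod (\<mu> b))) * R ^ d"
      by (intro mult_mono 1 2) auto
    also have "\<dots> \<le> c"
      unfolding c_def using b R
      by (intro member_le_sum[of "(b, d)", where f = "\<lambda>x. exp (R * ln (cmod (\<mu> (fst x)))) * R ^ snd x", simplified]) auto
    finally show ?thesis .
  next
    case False
    then have "E k m $ i $ j = 0" by (auto simp: E_def toeplitz_def)
    then show ?thesis unfolding c_def using R by (auto intro!: sum_nonneg)
  qed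
  define c1 where "c1 = entry_sum QB * (real CARD('n) * (real CARD('n) * c)) * entry_sum (matrix_inv QA)"
  have Wbound: "cmod (W k m $ i $ j) \<le> c1" if km: "\<bar>of_int k * a - of_int m * (t * a)\<bar> \<le> M" for k m i j
  proof -
    have "cmod (W k m $ i $ j) \<le> entry_sum (W k m)" by (rule norm_entry_le)
    also have "\<dots> \<le> entry_sum QB * entry_sum (E k m) * entry_sum (matrix_inv QA)"
      unfolding W by (rule entry_sum_mult3)
    also have "\<dots> \<le> c1"
      unfolding c1_def by (intro mult_right_mono mult_left_mono entry_sum_le Ebound km entry_sum_nonneg)
    finally show ?thesis .
  qed
  obtain z where z: "invertible (\<chi> i j. Re (S $ i $ j) + z * Im (S $ i $ j))"
    using real_combination_invertible[OF invS] by blast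
  define Sr where "Sr = (\<chi> i j. Re (S $ i $ j) + z * Im (S $ i $ j))"
  define T where "T k m = zpow B (- m) ** Sr ** zpow A k" for k m
  \<comment> \<open>The factor \<open>1 + \<bar>z\<bar>\<close> accounts for the real combination,
    and the maximum with 1 for the hypothesis \<open>1 \<le> c\<close> of the Cramer
    estimate.\<close>
  define c2 where "c2 = max 1 ((1 + \<bar>z\<bar>) * c1)"
  have Tbound: "\<bar>T k m $ i $ j\<bar> \<le> c2" if km: "\<bar>of_int k * a - of_int m * (t * a)\<bar> \<le> M" for k m i j
  proof -
    have "\<bar>T k m $ i $ j\<bar> = \<bar>Re (W k m $ i $ j) + z * Im (W k m $ i $ j)\<bar>"
      unfolding T_def Sr_def real_combination_mult W_def ..
    also have "\<dots> \<le> cmod (W k m $ i $ j) + \<bar>z\<bar> * cmod (W k m $ i $ j)"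
      by (intro order_trans[OF abs_triangle_ineq] add_mono abs_Re_le_cmod)
        (simp add: abs_mult mult_left_mono abs_Im_le_cmod)
    also have "\<dots> = (1 + \<bar>z\<bar>) * cmod (W k m $ i $ j)" by (simp add: algebra_simps)
    also have "\<dots> \<le> (1 + \<bar>z\<bar>) * c1" using Wbound[OF km] by (intro mult_left_mono) auto
    finally show ?thesis by (simp add: c2_def)
  qed
  \<comment> \<open>Up to sign, \<open>det (T k m)\<close> is \<open>det Sr\<close> times the
    exponential of \<open>k * a - m * (t * a)\<close>, and this exponent is at least
    \<open>- M\<close>.\<close>
  define \<delta> where "\<delta> = exp (- M) * \<bar>det Sr\<bar>"
  have \<delta>: "\<delta> > 0" using z by (simp add: \<delta>_def Sr_def invertible_det_nz)
  have Tdet: "\<delta> \<le> \<bar>det (T k m)\<bar>" if km: "\<bar>of_int k * a - of_int m * (t * a)\<bar> \<le> M" for k m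
  proof -
    have "\<bar>det (T k m)\<bar> = \<bar>det B\<bar> powi (- m) * \<bar>det Sr\<bar> * \<bar>det A\<bar> powi k"
      by (simp add: T_def det_mul det_zpow[OF invA] det_zpow[OF invB] abs_mult power_int_abs)
    also have "\<dots> = exp (of_int k * a - of_int m * (t * a)) * \<bar>det Sr\<bar>"
      using detA detB by (simp add: powi_eq_exp lnB a_def[symmetric] exp_diff exp_minus field_simps)
    also have "\<dots> \<ge> \<delta>"
      unfolding \<delta>_def using km by (intro mult_right_mono) auto
    finally show ?thesis .
  qed
  define c3 where "c3 = real CARD('n) * (fact CARD('n) * c2 ^ CARD('n) / \<delta>)"
  define c4 where "c4 = real CARD('n) * (real CARD('n) * c2)"
  have c2: "1 \<le> c2" by (simp add: c2_def)
  have pos: "0 < c3" using c2 \<delta> by (simp add: c3_def)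
  show ?thesis
  proof (rule linearly_equivalentI[OF expA expB z[folded Sr_def], of "max c3 c4" M])
    show "0 < max c3 c4" using pos by simp
    show "ln \<bar>det A\<bar> \<le> M" "ln \<bar>det B\<bar> \<le> M" by (simp_all add: lnB M_def a_def)
    fix k m and y :: "real^'n"
    assume "\<bar>real_of_int k * ln \<bar>det A\<bar> - real_of_int m * ln \<bar>det B\<bar>\<bar> \<le> M"
    then have km: "\<bar>of_int k * a - of_int m * (t * a)\<bar> \<le> M" by (simp add: lnB a_def)
    have T: "zpow B (- m) *v (Sr *v (zpow A k *v y)) = T k m *v y"
      by (simp add: T_def matrix_vector_mul_assoc matrix_mul_assoc)
    have "norm y \<le> c3 * norm (T k m *v y)"
      unfolding c3_def by (rule norm_le_of_det_ge[OF Tbound[OF km] c2 \<delta> Tdet[OF km]])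
    moreover have "norm (T k m *v y) \<le> c4 * norm y"
      using norm_matrix_vector_le[of "T k m" y] entry_sum_le[of "T k m" c2] Tbound[OF km]
      unfolding c4_def by (smt (verit) mult_right_mono norm_ge_zero real_norm_def)
    moreover have "c3 * w \<le> max c3 c4 * w" "c4 * w \<le> max c3 c4 * w" if "w \<ge> 0" for w
      using that by (auto intro: mult_right_mono)
    ultimately show "norm y \<le> max c3 c4 * norm (zpow B (- m) *v (Sr *v (zpow A k *v y)))
        \<and> norm (zpow B (- m) *v (Sr *v (zpow A k *v y))) \<le> max c3 c4 * norm y"
      unfolding T by (meson norm_ge_zero order_trans)
  qed
qed

section \<open>Reading off Jordan blocks\<close>

fun block_index :: "nat list \<Rightarrow> nat \<Rightarrow> nat \<times> nat" where
  "block_index [] m = (0, m)"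
| "block_index (s # ss) m = (if m < s then (0, m) else map_prod Suc id (block_index ss (m - s)))"

lemma block_index_less:
  "m < sum_list ss \<Longrightarrow> fst (block_index ss m) < length ss \<and> snd (block_index ss m) < ss ! fst (block_index ss m)"
  by (induction ss m rule: block_index.induct) auto

lemma sum_list_take_block_index:
  "m < sum_list ss \<Longrightarrow> sum_list (take (fst (block_index ss m)) ss) + snd (block_index ss m) = m"
proof (induction ss m rule: block_index.induct)
  case (2 s ss m)
  show ?case
  proof (cases "m < s")
    case False
    with 2(2) have "m - s < sum_list ss" by simp
    from 2(1)[OF False this] False show ?thesis by simp
  qed simp
qed simp

lemma block_index_sum_list_take:
  "b < length ss \<Longrightarrow> i < ss ! b \<Longrightarrow>
    sum_list (take b ss) + i < sum_list ss \<and> block_index ss (sum_list (take b ss) + i) = (b, i)"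
proof (induction ss arbitrary: b)
  case (Cons s ss)
  then show ?case by (cases b) auto
qed simp

lemma bij_betw_block_index:
  "bij_betw (block_index ss) {..<sum_list ss} (SIGMA b:{..<length ss}. {..<ss ! b})"
proof (rule bij_betw_byWitness[where f' = "\<lambda>(b, i). sum_list (take b ss) + i"])
  show "block_index ss ` {..<sum_list ss} \<subseteq> (SIGMA b:{..<length ss}. {..<ss ! b})"
  proof (rule image_subsetI)
    show "block_index ss m \<in> (SIGMA b:{..<length ss}. {..<ss ! b})" if "m \<in> {..<sum_list ss}" for m
      using block_index_less[of m ss] that by (cases "block_index ss m") auto
  qed
qed (auto simp: block_index_sum_list_take sum_list_take_block_index case_prod_unfold)

text \<open>Turns the recursive block-diagonal construction into an entry formula: the diagonal and
  superdiagonal are the two coefficients of the series \<open>\<mu> + X\<close> in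
  \<open>jordan_toeplitz\<close>.\<close>

lemma jordan_matrix_index:
  assumes "m < sum_list (map fst bs)" "m' < sum_list (map fst bs)"
  shows "jordan_matrix bs $$ (m, m') =
    (let x = block_index (map fst bs) m; y = block_index (map fst bs) m'
     in if fst x = fst y then if snd x = snd y then snd (bs ! fst x)
       else if Suc (snd x) = snd y then 1 else 0 else 0)"
  using assms
proof (induction bs arbitrary: m m')
  case (Cons sa bs)
  obtain s a where sa: "sa = (s, a)" by fastforce
  show ?case
    using Cons.IH[of "m - s" "m' - s"] Cons.prems
    by (auto simp: sa jordan_matrix_Cons Let_def)
qed simp

definition from_mat :: "('n \<Rightarrow> nat) \<Rightarrow> 'a mat \<Rightarrow> 'a^'n^'n" where
  "from_mat e M = (\<chi> i j. M $$ (e i, e j))"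

lemma from_mat_mult:
  assumes e: "bij_betw e (UNIV :: 'n::finite set) {..<n}"
    and M: "M \<in> carrier_mat n n" and N: "N \<in> carrier_mat n n"
  shows "from_mat e (M * N) = from_mat e M ** from_mat e N"
proof -
  have lt: "e i < n" for i using e by (auto simp: bij_betw_def)
  have "(M * N) $$ (e i, e j) = (\<Sum>k\<in>UNIV. M $$ (e i, e k) * N $$ (e k, e j))" for i j
    using M N lt sum.reindex_bij_betw[OF e, of "\<lambda>k. M $$ (e i, k) * N $$ (k, e j)"]
    by (simp add: scalar_prod_def atLeast0LessThan)
  then show ?thesis by (simp add: from_mat_def vec_eq_iff matrix_matrix_mult_def)
qed

lemma block_coords_cong:
  assumes "\<And>b. b < K \<Longrightarrow> s b = s' b"
  shows "block_coords \<beta> K s \<longleftrightarrow> block_coords \<beta> K s'"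
proof -
  have "(SIGMA b:{..<K}. {..<s b}) = (SIGMA b:{..<K}. {..<s' b})" using assms by auto
  then show ?thesis by (simp add: block_coords_def)
qed

lemma block_coords_block_index:
  assumes "bij_betw e (UNIV :: 'n::finite set) {..<CARD('n)}" "sum_list ss = CARD('n)"
  shows "block_coords (block_index ss \<circ> e) (length ss) (\<lambda>b. ss ! b)"
  unfolding block_coords_def using bij_betw_trans[OF assms(1)] bij_betw_block_index[of ss] assms(2)
  by simp

lemma from_mat_jordan_matrix:
  fixes e :: "'n::finite \<Rightarrow> nat"
  assumes e: "bij_betw e UNIV {..<CARD('n)}" and n: "sum_list (map fst bs) = CARD('n)"
  shows "from_mat e (jordan_matrix bs)
    = jordan_toeplitz (block_index (map fst bs) \<circ> e) (\<lambda>b. snd (bs ! b))"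
proof -
  have lt: "e i < CARD('n)" for i using e by (auto simp: bij_betw_def)
  show ?thesis
    by (auto simp: from_mat_def toeplitz_def vec_eq_iff jordan_matrix_index lt n Let_def fps_X_def)
qed

text \<open>Characteristic polynomials split over the complex numbers, so a complex Jordan normal
  form exists; \<open>e\<close> transports it to matrices indexed by the type.\<close>

lemma jordan_form_exists:
  fixes A :: "real^'n^'n" and e :: "'n \<Rightarrow> nat"
  assumes e: "bij_betw e UNIV {..<CARD('n)}"
  obtains bs P where "sum_list (map fst bs) = CARD('n)"
    "jordan_form A (block_index (map fst bs) \<circ> e) (length bs) (\<lambda>b. fst (bs ! b)) (\<lambda>b. snd (bs ! b)) P"
proof -
  let ?n = "CARD('n)"
  define Am where "Am = Matrix.mat ?n ?n (\<lambda>(i, j). complex_of_real (A $ inv_into UNIV e i $ inv_into UNIV e j))"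
  have lt: "e i < ?n" for i using e by (auto simp: bij_betw_def)
  have inj: "inj e" using e by (auto simp: bij_betw_def)
  have Am: "Am \<in> carrier_mat ?n ?n" by (simp add: Am_def)
  have Am': "from_mat e Am = map_matrix complex_of_real A"
    using lt inj by (simp add: from_mat_def Am_def vec_eq_iff)
  obtain es where "char_poly Am = (\<Prod>a\<leftarrow>es. [:- a, 1:])"
    using char_poly_factorized[OF Am] by auto
  then obtain bs where bs: "jordan_nf Am bs" using jordan_nf_exists[OF Am] by blast
  then obtain P Q where wit: "similar_mat_wit Am (jordan_matrix bs) P Q"
    unfolding jordan_nf_def similar_mat_def by blast
  from similar_mat_witD[OF _ this, of ?n] Am
  have PQ: "P * Q = 1\<^sub>m ?n" "Q * P = 1\<^sub>m ?n" "Am = P * jordan_matrix bs * Q"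
    and car: "jordan_matrix bs \<in> carrier_mat ?n ?n" "P \<in> carrier_mat ?n ?n" "Q \<in> carrier_mat ?n ?n"
    by auto
  have n: "sum_list (map fst bs) = ?n"
    using car(1) by (metis carrier_matD(1) jordan_matrix_dim(1))
  have one: "from_mat e (1\<^sub>m ?n :: complex mat) = mat 1"
    using lt inj by (auto simp: from_mat_def vec_eq_iff mat_def inj_eq)
  have "invertible (from_mat e P)"
    unfolding invertible_def
    using from_mat_mult[OF e car(2,3)] from_mat_mult[OF e car(3,2)] one PQ by metis
  moreover have "Am * P = P * jordan_matrix bs"
    using car PQ right_mult_one_mat[OF car(1)] by (simp add: assoc_mult_mat[of _ ?n ?n _ ?n _ ?n])
  then have "map_matrix complex_of_real A ** from_mat e P
      = from_mat e P ** jordan_toeplitz (block_index (map fst bs) \<circ> e) (\<lambda>b. snd (bs ! b))"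
    by (metis Am Am' car(1,2) e from_mat_jordan_matrix from_mat_mult n)
  moreover have "block_coords (block_index (map fst bs) \<circ> e) (length bs) (\<lambda>b. fst (bs ! b))"
    using block_coords_block_index[OF e n] block_coords_cong[of "length bs" "\<lambda>b. map fst bs ! b" "\<lambda>b. fst (bs ! b)"
        "block_index (map fst bs) \<circ> e"]
    by simp
  moreover have "\<forall>b<length bs. 0 < fst (bs ! b)"
    using bs by (metis bot_nat_0.not_eq_extremum image_eqI jordan_nf_def nth_mem)
  ultimately show ?thesis using that[OF n] by (simp add: jordan_form_def)
qed

text \<open>Permuting the block numbers renames coordinates and leaves the matrix itself untouched.
  It reconciles the prescribed order of the canonical blocks with the order in which the Jordan form
  of \<open>A\<close> delivers them.\<close>

lemma relabel_blocks:
  assumes \<gamma>: "block_coords \<gamma> K s" and \<pi>: "bij_betw \<pi> {..<K} {..<K}"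
  obtains \<gamma>' where "block_coords \<gamma>' K (\<lambda>b. s (\<pi> b))"
    "jordan_toeplitz \<gamma>' (\<lambda>b. \<nu> (\<pi> b)) = jordan_toeplitz \<gamma> \<nu>"
proof
  define \<tau> where "\<tau> = inv_into {..<K} \<pi>"
  have \<tau>: "bij_betw \<tau> {..<K} {..<K}" using \<pi> by (simp add: \<tau>_def bij_betw_inv_into)
  have \<pi>\<tau>: "\<pi> (\<tau> b) = b" if "b < K" for b
    using \<pi> that by (simp add: \<tau>_def bij_betw_inv_into_right)
  have \<tau>\<pi>: "\<tau> (\<pi> b) = b" if "b < K" for b
    using \<pi> that by (simp add: \<tau>_def bij_betw_inv_into_left)
  have lt: "\<tau> b < K" "\<pi> b < K" if "b < K" for b
    using \<tau> \<pi> that by (auto simp: bij_betw_def)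
  have "bij_betw (map_prod \<tau> id) (SIGMA b:{..<K}. {..<s b}) (SIGMA b:{..<K}. {..<s (\<pi> b)})"
    by (rule bij_betw_byWitness[where f' = "map_prod \<pi> id"]) (auto simp: \<pi>\<tau> \<tau>\<pi> lt)
  then show "block_coords (map_prod (inv_into {..<K} \<pi>) id \<circ> \<gamma>) K (\<lambda>b. s (\<pi> b))"
    using \<gamma> unfolding block_coords_def \<tau>_def by (rule bij_betw_trans[rotated])
  have "\<tau> (fst (\<gamma> i)) = \<tau> (fst (\<gamma> j)) \<longleftrightarrow> fst (\<gamma> i) = fst (\<gamma> j)" for i j
    using block_coords_less(1)[OF \<gamma>] \<pi>\<tau> by metis
  then show "jordan_toeplitz (map_prod (inv_into {..<K} \<pi>) id \<circ> \<gamma>) (\<lambda>b. \<nu> (\<pi> b)) = jordan_toeplitz \<gamma> \<nu>"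
    unfolding \<tau>_def[symmetric] using block_coords_less(1)[OF \<gamma>]
    by (auto simp: toeplitz_def vec_eq_iff \<pi>\<tau>)
qed

lemma jordan_blocks_Cons:
  "jordan_blocks (l # ls) (p # ps) = map (\<lambda>s. (s, l)) p @ jordan_blocks ls ps"
  by (simp add: jordan_blocks_def)

lemma sum_list_jordan_blocks:
  "length ls = length ps \<Longrightarrow> sum_list (map fst (jordan_blocks ls ps)) = sum_list (map sum_list ps)"
  by (induction ls ps rule: list_induct2) (simp_all add: jordan_blocks_Cons o_def, simp add: jordan_blocks_def)

lemma prod_list_jordan_blocks:
  fixes ls :: "real list"
  shows "length ls = length ps \<Longrightarrow>
    prod_list (map (\<lambda>x. snd x ^ fst x) (jordan_blocks ls ps)) = (\<Prod>i<length ls. (ls ! i) ^ sum_list (ps ! i))"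
proof (induction ls ps rule: list_induct2)
  case (Cons l ls p ps)
  have "prod_list (map (\<lambda>s. l ^ s) p) = l ^ sum_list p" by (induction p) (simp_all add: power_add)
  then show ?case
    using Cons by (simp add: jordan_blocks_Cons o_def prod.lessThan_Suc_shift del: prod.lessThan_Suc)
qed (simp add: jordan_blocks_def)

lemma set_jordan_blocks:
  assumes "length ls = length ps"
  shows "set (jordan_blocks ls ps) = {(s, ls ! i) | s i. i < length ls \<and> s \<in> set (ps ! i)}"
  using assms by (auto simp: jordan_blocks_def set_zip)

lemma prod_block_values:
  assumes "block_coords \<beta> (length bs) (\<lambda>b. fst (bs ! b))"
  shows "(\<Prod>i\<in>UNIV. snd (bs ! fst (\<beta> i))) = prod_list (map (\<lambda>x. snd x ^ fst x :: real) bs)"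
  using prod_block_coords[OF assms, of "\<lambda>x. snd (bs ! fst x)"]
  by (simp add: prod.list_conv_set_nth atLeast0LessThan)

section \<open>Arbitrary quasi-norms\<close>

lemma quasi_normD:
  assumes "quasi_norm A \<rho>"
  shows "\<rho> \<in> borel_measurable lebesgue" "0 \<le> \<rho> x" "\<rho> x = 0 \<longleftrightarrow> x = 0"
    "\<rho> (A *v x) = \<bar>det A\<bar> * \<rho> x"
  using assms by (auto simp: quasi_norm_def)

lemma quasi_norm_zpow:
  assumes \<rho>: "quasi_norm A \<rho>" and A: "invertible A"
  shows "\<rho> (zpow A k *v x) = \<bar>det A\<bar> powi k * \<rho> x"
proof -
  have d: "\<bar>det A\<bar> \<noteq> 0" using A by (simp add: invertible_det_nz)
  have step: "\<rho> (zpow A (k + 1) *v x) = \<bar>det A\<bar> * \<rho> (zpow A k *v x)" for k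
    using quasi_normD(4)[OF \<rho>, of "zpow A k *v x"]
    by (simp add: zpow_Suc[OF A] matrix_vector_mul_assoc)
  show ?thesis
  proof (induction k rule: int_induct[where k = 0])
    case (step1 i)
    then show ?case using d by (simp add: step power_int_add_1')
  next
    case (step2 i)
    have "\<bar>det A\<bar> * \<rho> (zpow A (i - 1) *v x) = \<bar>det A\<bar> * (\<bar>det A\<bar> powi (i - 1) * \<rho> x)"
      using step2 step[of "i - 1"] d power_int_add_1'[of "\<bar>det A\<bar>" "i - 1"] by simp
    then show ?case using d by simp
  qed simp
qed

text \<open>If \<open>\<rho> \<le> M\<close> on most of the unit ball, then for every small \<open>z\<close> some \<open>x\<close> has
  \<open>\<rho> x \<le> M\<close> and \<open>\<rho> (z - x) \<le> M\<close>; the quasi-triangle inequality does the rest. No symmetry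
  of \<open>\<rho>\<close> is available here.\<close>

lemma quasi_norm_bounded:
  fixes A :: "real^'n^'n"
  assumes \<rho>: "quasi_norm A \<rho>"
  obtains C where "C > 0" "\<And>x. norm x \<le> 1 \<Longrightarrow> \<rho> x \<le> C"
proof -
  obtain c where c: "c > 0" "\<And>x y. \<rho> (x + y) \<le> c * (\<rho> x + \<rho> y)"
    using \<rho> unfolding quasi_norm_def by blast
  define U where "U = cball (0 :: real^'n) 1"
  define E where "E M = {x \<in> U. real M < \<rho> x}" for M :: nat
  have U: "U \<in> lmeasurable" by (simp add: U_def)
  have EU: "E M \<subseteq> U" for M by (auto simp: E_def)
  have Es: "E M \<in> sets lebesgue" for M
  proof -
    have "{x. real M < \<rho> x} \<in> sets lebesgue"
      using borel_measurable_less[OF borel_measurable_const quasi_normD(1)[OF \<rho>], of "real M"] by simp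
    then show ?thesis
      unfolding E_def using U by (simp add: Collect_conj_eq fmeasurableD sets.Int)
  qed
  have Em: "E M \<in> lmeasurable" for M
    using fmeasurableI2[OF U EU Es] .
  define v where "v = measure lebesgue (cball (0 :: real^'n) (1 / 2))"
  have v: "v > 0" unfolding v_def using content_cball_pos[of "1 / 2" "0 :: real^'n"] by simp
  have "(\<lambda>M. measure lebesgue (E M)) \<longlonglongrightarrow> measure lebesgue (\<Inter>M. E M)"
  proof (rule Lim_measure_decseq)
    show "range E \<subseteq> sets lebesgue" using Es by auto
    show "decseq E" by (auto simp: decseq_def E_def)
    show "emeasure lebesgue (E M) \<noteq> \<infinity>" for M using Em[of M] by (auto simp: fmeasurable_def)
  qed
  moreover have "(\<Inter>M. E M) = {}"
    by (auto simp: E_def) (meson not_less reals_Archimedean2 less_asym)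
  ultimately have "(\<lambda>M. measure lebesgue (E M)) \<longlonglongrightarrow> 0" by simp
  then obtain M where M: "measure lebesgue (E M) < v / 2"
    using order_tendstoD(2)[of _ 0 sequentially "v / 2"] v by (force simp: eventually_sequentially)
  have "\<rho> z \<le> c * (2 * real M)" if z: "norm z \<le> 1" for z
  proof -
    \<comment> \<open>This ball lies in the unit ball, is mapped to itself by
      \<open>x \<mapsto> z - x\<close>, and has a volume independent of \<open>z\<close>. The bad
      set \<open>E M\<close> and its reflection \<open>F\<close> each have measure below
      \<open>v / 2\<close>, so they cannot cover it.\<close>
    define V where "V = cball ((1 / 2) *\<^sub>R z) (1 / 2)"
    have VU: "x \<in> U" "z - x \<in> V" if "x \<in> V" for x
    proof -
      have "norm x \<le> norm ((1 / 2) *\<^sub>R z) + norm (x - (1 / 2) *\<^sub>R z)"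
        by (metis add.commute diff_add_cancel norm_triangle_ineq)
      then show "x \<in> U" using that z by (simp add: U_def V_def dist_norm norm_minus_commute)
      have "(1 / 2) *\<^sub>R z - (z - x) = x - (1 / 2) *\<^sub>R z"
        by (simp add: algebra_simps flip: scaleR_add_left)
      then have "norm ((1 / 2) *\<^sub>R z - (z - x)) = norm ((1 / 2) *\<^sub>R z - x)"
        by (metis norm_minus_commute)
      then show "z - x \<in> V" using that unfolding V_def mem_cball dist_norm by simp
    qed
    have "V = (+) ((1 / 2) *\<^sub>R z) ` cball 0 (1 / 2)" by (simp add: V_def)
    then have mV: "measure lebesgue V = v" unfolding v_def by (simp only: measure_translation)
    define F where "F = (\<lambda>x. z - x) ` E M"
    have Feq: "F = (\<lambda>x. (-1) *\<^sub>R x + z) ` E M" by (simp add: F_def)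
    have mF: "measure lebesgue F = measure lebesgue (E M)"
      using measure_lebesgue_affine[of "-1" z "E M"] by (simp add: Feq)
    have "uminus ` E M = (\<lambda>x. (-1) *\<^sub>R x) -` E M \<inter> space lebesgue"
      by (auto simp: image_iff) (metis minus_minus)
    also have "\<dots> \<in> sets lebesgue"
      by (rule measurable_sets[OF lebesgue_measurable_scaling Es])
    finally have "(+) z ` uminus ` E M \<in> sets lebesgue" by (rule lebesgue_sets_translation)
    then have Fs: "F \<in> sets lebesgue" by (simp add: F_def image_image)
    have "norm (z - x) \<le> 2" if "x \<in> E M" for x
      using norm_triangle_ineq4[of z x] z that by (simp add: E_def U_def)
    then have "F \<subseteq> cball 0 2" by (auto simp: F_def)
    from fmeasurableI2[OF lmeasurable_cball this Fs] have Fm: "F \<in> lmeasurable" .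
    have "\<not> V \<subseteq> E M \<union> F"
    proof
      assume "V \<subseteq> E M \<union> F"
      then have "measure lebesgue V \<le> measure lebesgue (E M \<union> F)"
        using Em Fm by (intro measure_mono_fmeasurable) (auto simp: V_def)
      also have "\<dots> \<le> measure lebesgue (E M) + measure lebesgue F"
        using Es Fs by (rule measure_Un_le)
      finally show False using M mV mF by simp
    qed
    then obtain x where x: "x \<in> V" "x \<notin> E M" "x \<notin> F" by auto
    have "z - x \<notin> E M" using x(3) by (auto simp: F_def image_iff)
    then have "\<rho> x \<le> real M" "\<rho> (z - x) \<le> real M"
      using x VU[OF x(1)] VU(1)[OF VU(2)[OF x(1)]] by (auto simp: E_def)
    then have "c * (\<rho> x + \<rho> (z - x)) \<le> c * (2 * real M)" using c(1) by (intro mult_left_mono) auto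
    then show ?thesis using c(2)[of x "z - x"] by simp
  qed
  \<comment> \<open>\<open>M\<close> may be 0, so 1 is added to obtain a positive constant.\<close>
  moreover have "c * (2 * real M) < c * (2 * real M) + 1" by simp
  ultimately show ?thesis using that[of "c * (2 * real M) + 1"] c(1) by (smt (verit) mult_nonneg_nonneg of_nat_0_le_iff)
qed

lemma norm_mult_zpow_le:
  fixes A :: "real^'n^'n"
  shows "norm (zpow A k *v x) \<le> (entry_sum (zpow A k) + 1) * norm x"
  using norm_matrix_vector_le[of "zpow A k" x] by (simp add: distrib_right add_increasing2)

text \<open>Homogeneity improves the bound \<open>C\<close> on the unit ball to
  \<open>C / \<bar>det A\<bar> ^ k\<close> on the ball that \<open>zpow A k\<close> maps into
  it.\<close>

lemma quasi_norm_small: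
  fixes A :: "real^'n^'n"
  assumes \<rho>: "quasi_norm A \<rho>" and A: "expanding A" and \<eta>: "\<eta> > 0"
  obtains \<delta> where "\<delta> > 0" "\<And>x. norm x \<le> \<delta> \<Longrightarrow> \<rho> x < \<eta>"
proof -
  have inv: "invertible A" and d: "1 < \<bar>det A\<bar>" using A by (auto simp: expanding_def)
  obtain C where C: "C > 0" "\<And>x. norm x \<le> 1 \<Longrightarrow> \<rho> x \<le> C" using quasi_norm_bounded[OF \<rho>] by blast
  obtain k where k: "C / \<eta> < \<bar>det A\<bar> ^ k" using real_arch_pow[OF d] by blast
  define r where "r = entry_sum (zpow A (int k)) + 1"
  have r: "r > 0" using entry_sum_nonneg[of "zpow A (int k)"] by (simp add: r_def)
  have "\<rho> x < \<eta>" if "norm x \<le> 1 / r" for x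
  proof -
    have "norm (zpow A (int k) *v x) \<le> r * norm x"
      using norm_mult_zpow_le by (simp add: r_def)
    also have "\<dots> \<le> 1" using that r by (simp add: field_simps)
    finally have "\<bar>det A\<bar> ^ k * \<rho> x \<le> C"
      using C(2)[of "zpow A (int k) *v x"] quasi_norm_zpow[OF \<rho> inv, of "int k" x] by simp
    also have "C < \<bar>det A\<bar> ^ k * \<eta>" using k \<eta> by (simp add: field_simps)
    finally show ?thesis using d by (simp add: mult_less_cancel_left)
  qed
  then show ?thesis using that[of "1 / r"] r by simp
qed

text \<open>Without continuity a minimum need not be attained. A limit \<open>l\<close> of points
  with quasi-norm tending to 0 nevertheless has quasi-norm 0, by the quasi-triangle inequality and
  smallness of \<open>\<rho>\<close> near 0 applied to \<open>l - X n\<close>.\<close>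

lemma quasi_norm_annulus:
  fixes A :: "real^'n^'n"
  assumes \<rho>: "quasi_norm A \<rho>" and A: "expanding A"
  obtains \<delta> where "\<delta> > 0" "\<And>x. 1 \<le> norm x \<Longrightarrow> norm x \<le> r \<Longrightarrow> \<delta> \<le> \<rho> x"
proof (rule ccontr)
  assume "\<not> thesis"
  then have no: "\<forall>\<delta>>0. \<exists>x. 1 \<le> norm x \<and> norm x \<le> r \<and> \<rho> x < \<delta>"
    using that by (meson not_less)
  obtain c where c: "c > 0" "\<And>x y. \<rho> (x + y) \<le> c * (\<rho> x + \<rho> y)"
    using \<rho> unfolding quasi_norm_def by blast
  have "\<forall>n::nat. \<exists>x. 1 \<le> norm x \<and> norm x \<le> r \<and> \<rho> x < 1 / real (Suc n)"
    using no by simp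
  then obtain X where X: "\<And>n::nat. 1 \<le> norm (X n) \<and> norm (X n) \<le> r \<and> \<rho> (X n) < 1 / real (Suc n)"
    by metis
  define K where "K = cball (0 :: real^'n) r - ball 0 1"
  have "compact K" unfolding K_def by (intro compact_diff compact_cball open_ball)
  moreover have "\<forall>n. X n \<in> K" using X by (auto simp: K_def not_less)
  ultimately obtain l h where l: "l \<in> K" and h: "strict_mono h" "(X \<circ> h) \<longlonglongrightarrow> l"
    unfolding compact_def by blast
  have "\<rho> l \<le> c * (2 * \<eta>)" if \<eta>: "\<eta> > 0" for \<eta>
  proof -
    obtain \<delta> where \<delta>: "\<delta> > 0" "\<And>x. norm x \<le> \<delta> \<Longrightarrow> \<rho> x < \<eta>"
      using quasi_norm_small[OF \<rho> A \<eta>] by blast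
    have "eventually (\<lambda>n. dist ((X \<circ> h) n) l < \<delta>) sequentially" using h(2) \<delta>(1) by (rule tendstoD)
    moreover have "eventually (\<lambda>n. 1 / real (Suc n) < \<eta>) sequentially"
      using \<eta> by real_asymp
    ultimately have "eventually (\<lambda>n. dist ((X \<circ> h) n) l < \<delta> \<and> 1 / real (Suc n) < \<eta>) sequentially"
      by (rule eventually_conj)
    then obtain n where n: "dist (X (h n)) l < \<delta>" "1 / real (Suc n) < \<eta>"
      by (auto simp: eventually_sequentially)
    have "1 / real (Suc (h n)) \<le> 1 / real (Suc n)"
      using seq_suble[OF h(1), of n] by (intro frac_le) auto
    then have "\<rho> (X (h n)) < \<eta>" using X[of "h n"] n(2) by linarith
    moreover have "\<rho> (l - X (h n)) < \<eta>"
      using n(1) by (intro \<delta>(2)) (simp add: dist_norm norm_minus_commute)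
    ultimately have "c * (\<rho> (X (h n)) + \<rho> (l - X (h n))) \<le> c * (2 * \<eta>)"
      using c(1) by (intro mult_left_mono) auto
    then show ?thesis using c(2)[of "X (h n)" "l - X (h n)"] by simp
  qed
  \<comment> \<open>For positive \<open>\<rho> l\<close> this choice would give
    \<open>\<rho> l \<le> \<rho> l / 2\<close>.\<close>
  from this[of "\<rho> l / (4 * c)"] have "\<rho> l \<le> 0"
    using c(1) quasi_normD(2)[OF \<rho>, of l] by (cases "\<rho> l = 0") (auto simp: field_simps)
  then have "l = 0" using quasi_normD(2,3)[OF \<rho>, of l] by simp
  then show False using l by (simp add: K_def)
qed

text \<open>Every nonzero \<open>x\<close> is \<open>zpow A j *v z\<close> with \<open>z\<close> in
  a fixed annulus, where \<open>\<rho>\<close> is at least \<open>\<delta>\<close>. A bound on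
  \<open>\<rho> x\<close> then bounds the level \<open>j\<close>, and hence the norm.\<close>

lemma quasi_norm_sublevel_bounded:
  fixes A :: "real^'n^'n"
  assumes \<rho>: "quasi_norm A \<rho>" and A: "expanding A"
  obtains R where "R > 0" "\<And>x. \<rho> x \<le> C \<Longrightarrow> norm x \<le> R"
proof -
  have inv: "invertible A" and d: "1 < \<bar>det A\<bar>" using A by (auto simp: expanding_def)
  \<comment> \<open>The outer radius is a bound for one application of \<open>A\<close>: one step
    beyond the level the norm is already below 1.\<close>
  obtain \<delta> where \<delta>: "\<delta> > 0" "\<And>x. 1 \<le> norm x \<Longrightarrow> norm x \<le> entry_sum (zpow A 1) + 1 \<Longrightarrow> \<delta> \<le> \<rho> x"
    using quasi_norm_annulus[OF \<rho> A] by blast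
  obtain J where J: "C / \<delta> < \<bar>det A\<bar> ^ J" using real_arch_pow[OF d] by blast
  define R where "R = entry_sum (zpow A (int J)) + 1"
  have R: "R > 0" using entry_sum_nonneg[of "zpow A (int J)"] by (simp add: R_def)
  have "norm x \<le> R" if x: "\<rho> x \<le> C" for x
  proof (cases "x = 0")
    case False
    define j where "j = level A x"
    define z where "z = zpow A (- j) *v x"
    have z1: "1 \<le> norm z" using level_attained(1)[OF A False] by (simp add: z_def j_def)
    have "z = zpow A 1 *v (zpow A (- (j + 1)) *v x)"
      by (simp add: z_def flip: zpow_shift[OF inv])
    then have "norm z \<le> (entry_sum (zpow A 1) + 1) * norm (zpow A (- (j + 1)) *v x)"
      using norm_mult_zpow_le by metis
    also have "\<dots> \<le> (entry_sum (zpow A 1) + 1) * 1"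
      using level_attained(2)[OF A False, of "j + 1"] entry_sum_nonneg[of "zpow A 1"]
      by (intro mult_left_mono) (auto simp: j_def)
    finally have "\<delta> \<le> \<rho> z" using \<delta>(2)[OF z1] by simp
    moreover have "\<rho> x = \<bar>det A\<bar> powi j * \<rho> z"
      using quasi_norm_zpow[OF \<rho> inv, of j z] by (simp add: z_def flip: zpow_shift[OF inv])
    moreover have "\<bar>det A\<bar> powi j * \<delta> \<le> \<bar>det A\<bar> powi j * \<rho> z"
      using \<open>\<delta> \<le> \<rho> z\<close> by (intro mult_left_mono) auto
    ultimately have "\<bar>det A\<bar> powi j * \<delta> \<le> C"
      using x by linarith
    then have "\<bar>det A\<bar> powi j \<le> C / \<delta>" using \<delta>(1) by (simp add: field_simps)
    then have "\<bar>det A\<bar> powi j < \<bar>det A\<bar> powi int J" using J by simp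
    then have "j < int J" using d power_int_increasing[of "int J" j "\<bar>det A\<bar>"] by force
    then have "norm (zpow A (- int J) *v x) \<le> 1"
      using level_attained(2)[OF A False, of "int J"] by (simp add: j_def)
    moreover have "x = zpow A (int J) *v (zpow A (- int J) *v x)"
      by (simp flip: zpow_shift[OF inv])
    then have "norm x \<le> R * norm (zpow A (- int J) *v x)"
      using norm_mult_zpow_le unfolding R_def by metis
    ultimately show ?thesis using R by (meson less_imp_le mult_left_le order_trans)
  qed (use R in simp)
  then show ?thesis using that R by blast
qed

text \<open>After \<open>y\<close> is scaled so that \<open>zpow A n\<close> takes it into the unit
  ball, \<open>\<rho>\<^sub>1\<close> is bounded there. Equal determinants let the factor
  \<open>\<bar>det A\<bar> ^ n\<close> pass from \<open>\<rho>\<^sub>1\<close> to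
  \<open>\<rho>\<^sub>2\<close>, and bounded sublevel sets return a norm estimate. The scaling
  precedes any use of the quasi-norms, which are homogeneous only under the dilation.\<close>

lemma linearly_equivalent_orbits:
  fixes A B :: "real^'n^'n"
  assumes eq: "linearly_equivalent A B" and A: "expanding A" and B: "expanding B"
    and det: "\<bar>det A\<bar> = \<bar>det B\<bar>"
  obtains S :: "real^'n^'n" and C where "invertible S" "C > 0"
    "\<And>n y. norm (zpow B (int n) *v (S *v y)) \<le> C * norm (zpow A (int n) *v y)"
proof -
  have invA: "invertible A" and invB: "invertible B" and d: "1 < \<bar>det B\<bar>" using A B by (auto simp: expanding_def)
  obtain \<rho>\<^sub>1 \<rho>\<^sub>2 c and S :: "real^'n^'n" where
    \<rho>: "quasi_norm A \<rho>\<^sub>1" "quasi_norm B \<rho>\<^sub>2" and c: "c > 0" and S: "invertible S"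
    and le: "\<And>x. \<rho>\<^sub>2 (S *v x) \<le> c * \<rho>\<^sub>1 x"
    using eq unfolding linearly_equivalent_def by blast
  obtain C1 where C1: "C1 > 0" "\<And>x. norm x \<le> 1 \<Longrightarrow> \<rho>\<^sub>1 x \<le> C1"
    using quasi_norm_bounded[OF \<rho>(1)] by blast
  obtain R where R: "R > 0" "\<And>x. \<rho>\<^sub>2 x \<le> c * C1 \<Longrightarrow> norm x \<le> R"
    using quasi_norm_sublevel_bounded[OF \<rho>(2) B] by blast
  have "norm (zpow B (int n) *v (S *v y)) \<le> R * norm (zpow A (int n) *v y)" for n y
  proof (cases "y = 0")
    case False
    define r where "r = norm (zpow A (int n) *v y)"
    have "zpow A (- int n) *v (zpow A (int n) *v y) = y"
      by (simp flip: zpow_shift[OF invA])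
    then have r: "r > 0" using False by (auto simp: r_def)
    define w where "w = (1 / r) *\<^sub>R y"
    have "norm (zpow A (int n) *v w) \<le> 1"
      using r by (simp add: w_def matrix_vector_mult_scaleR r_def)
    then have "\<bar>det A\<bar> powi int n * \<rho>\<^sub>1 w \<le> C1"
      using C1(2) quasi_norm_zpow[OF \<rho>(1) invA, of "int n" w] by metis
    then have "c * (\<bar>det B\<bar> ^ n * \<rho>\<^sub>1 w) \<le> c * C1" using c det by simp
    moreover have "\<bar>det B\<bar> ^ n * \<rho>\<^sub>2 (S *v w) \<le> \<bar>det B\<bar> ^ n * (c * \<rho>\<^sub>1 w)"
      using le[of w] by (intro mult_left_mono) auto
    ultimately have "\<rho>\<^sub>2 (zpow B (int n) *v (S *v w)) \<le> c * C1"
      using quasi_norm_zpow[OF \<rho>(2) invB, of "int n" "S *v w"] by (simp add: algebra_simps)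
    from R(2)[OF this] show ?thesis
      using r by (simp add: w_def matrix_vector_mult_scaleR r_def[symmetric] field_simps)
  qed simp
  then show ?thesis using that[OF S R(1)] by blast
qed

lemma linearly_equivalent_sym:
  fixes A B :: "real^'n^'n"
  assumes "linearly_equivalent A B"
  shows "linearly_equivalent B A"
proof -
  obtain \<rho>\<^sub>1 \<rho>\<^sub>2 c and S :: "real^'n^'n" where
    \<rho>: "quasi_norm A \<rho>\<^sub>1" "quasi_norm B \<rho>\<^sub>2" and c: "c > 0" and S: "invertible S"
    and le: "\<And>x. (1 / c) * \<rho>\<^sub>1 x \<le> \<rho>\<^sub>2 (S *v x) \<and> \<rho>\<^sub>2 (S *v x) \<le> c * \<rho>\<^sub>1 x"
    using assms unfolding linearly_equivalent_def by blast
  let ?S' = "matrix_inv S"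
  have SS: "S *v (?S' *v x) = x" for x
    by (simp add: matrix_vector_mul_assoc matrix_inv_right[OF S])
  have "invertible ?S'" by (rule invertible_matrix_inv[OF S])
  moreover have "(1 / c) * \<rho>\<^sub>2 x \<le> \<rho>\<^sub>1 (?S' *v x) \<and> \<rho>\<^sub>1 (?S' *v x) \<le> c * \<rho>\<^sub>2 x" for x
    using le[of "?S' *v x"] c by (simp add: SS field_simps)
  ultimately show ?thesis
    unfolding linearly_equivalent_def using \<rho> c by blast
qed

section \<open>Growth of orbits\<close>

lemma exp_flow_axis_le:
  fixes \<nu> :: "nat \<Rightarrow> real" and \<beta> :: "'n::finite \<Rightarrow> nat \<times> nat"
  assumes \<beta>: "block_coords \<beta> K s" and \<nu>: "\<And>b. b < K \<Longrightarrow> 1 < \<nu> b" and n: "1 \<le> n"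
  shows "norm (toeplitz \<beta> \<beta> (\<lambda>b. exp_series (\<nu> b powi int n) (of_int (int n) * 1)) *v axis j 1 :: real^'n)
    \<le> real CARD('n) * (\<nu> (fst (\<beta> j)) ^ n * real n ^ snd (\<beta> j))"
proof -
  let ?T = "toeplitz \<beta> \<beta> (\<lambda>b. exp_series (\<nu> b powi int n) (of_int (int n) * 1))"
  have \<nu>j: "\<nu> (fst (\<beta> j)) > 0" using \<nu> block_coords_less(1)[OF \<beta>, of j] by force
  have "\<bar>(?T *v axis j 1) $ i\<bar> \<le> \<nu> (fst (\<beta> j)) ^ n * real n ^ snd (\<beta> j)" for i
  proof -
    have "(?T *v axis j 1) $ i = ?T $ i $ j"
      by (simp add: matrix_vector_mult_def axis_def mult_delta_right)
    moreover have "real n ^ d / fact d \<le> real n ^ snd (\<beta> j)" if "d \<le> snd (\<beta> j)" for d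
    proof -
      have "real n ^ d / fact d \<le> real n ^ d / 1"
        by (intro frac_le) (auto simp: fact_ge_1)
      also have "\<dots> \<le> real n ^ snd (\<beta> j)" using n that by (simp add: power_increasing)
      finally show ?thesis .
    qed
    then have "\<nu> (fst (\<beta> j)) ^ n * (real n ^ d / fact d) \<le> \<nu> (fst (\<beta> j)) ^ n * real n ^ snd (\<beta> j)"
      if "d \<le> snd (\<beta> j)" for d
      using that \<nu>j by (intro mult_left_mono) auto
    ultimately show ?thesis
      using \<nu>j by (auto simp: toeplitz_def fps_nth_exp_series abs_mult)
  qed
  then show ?thesis
    using norm_le_l1_cart[of "?T *v axis j 1"]
      sum_bounded_above[of UNIV "\<lambda>i. \<bar>(?T *v axis j 1) $ i\<bar>" "\<nu> (fst (\<beta> j)) ^ n * real n ^ snd (\<beta> j)"]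
    by simp
qed

lemma power_ratio_tendsto_0:
  assumes "p < (q :: nat)"
  shows "(\<lambda>n. real n ^ p / real n ^ q) \<longlonglongrightarrow> 0"
proof -
  have "(\<lambda>n. (1 / real n) ^ (q - p)) \<longlonglongrightarrow> 0 ^ (q - p)"
    by (intro tendsto_power lim_1_over_n)
  moreover have "eventually (\<lambda>n. (1 / real n) ^ (q - p) = real n ^ p / real n ^ q) sequentially"
    using eventually_gt_at_top[of 0]
  proof eventually_elim
    case (elim n)
    have "real n ^ q = real n ^ p * real n ^ (q - p)"
      using assms by (simp flip: power_add)
    then show ?case using elim by (simp add: power_divide)
  qed
  ultimately show ?thesis using assms by (simp add: power_0_left filterlim_cong)
qed

text \<open>The strict lexicographic order, which for positive bases is the order of growth of
  \<open>r ^ n * n ^ p\<close>.\<close>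

definition label_less :: "real \<Rightarrow> nat \<Rightarrow> real \<Rightarrow> nat \<Rightarrow> bool" where
  "label_less r p a q \<longleftrightarrow> r < a \<or> (r = a \<and> p < q)"

lemma growth_ratio_tendsto_0:
  assumes "label_less r p a q" "0 < r"
  shows "(\<lambda>n. r ^ n * real n ^ p / (a ^ n * real n ^ q)) \<longlonglongrightarrow> 0"
  using assms(1) unfolding label_less_def
proof
  assume ra: "r < a"
  have lim: "(\<lambda>n. real n ^ p * (r / a) ^ n) \<longlonglongrightarrow> 0"
    using ra assms(2) by (intro power_times_geometric_tendsto_0) auto
  have bound: "norm (r ^ n * real n ^ p / (a ^ n * real n ^ q)) \<le> real n ^ p * (r / a) ^ n" if "1 \<le> n" for n
  proof -
    have "real n ^ p * (r / a) ^ n / real n ^ q \<le> real n ^ p * (r / a) ^ n / 1"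
      using that ra assms(2) by (intro frac_le) auto
    then show ?thesis
      using that ra assms(2) by (simp add: abs_mult power_divide field_simps)
  qed
  show ?thesis
    by (rule Lim_null_comparison[OF _ lim]) (use bound eventually_sequentially in blast)
next
  assume ra: "r = a \<and> p < q"
  then show ?thesis using power_ratio_tendsto_0[of p q] assms(2) by simp
qed

text \<open>In the block of the nonzero coordinate \<open>z $ i\<close> of largest position, the first row of
  the flow has exact growth \<open>\<nu>\<^sup>n n\<^sup>q\<close>.\<close>

lemma growth_bound_imp_zero:
  fixes \<nu> :: "nat \<Rightarrow> real" and \<beta> :: "'n::finite \<Rightarrow> nat \<times> nat" and z :: "real^'n"
  assumes \<beta>: "block_coords \<beta> K s" and \<nu>: "\<And>b. b < K \<Longrightarrow> 1 < \<nu> b" and r: "0 < r"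
    and le: "\<And>n. 1 \<le> n \<Longrightarrow>
      norm (toeplitz \<beta> \<beta> (\<lambda>b. exp_series (\<nu> b powi int n) (of_int (int n) * 1)) *v z) \<le> C * (r ^ n * real n ^ p)"
    and i: "label_less r p (\<nu> (fst (\<beta> i))) (snd (\<beta> i))"
  shows "z $ i = 0"
proof (rule ccontr)
  assume zi: "z $ i \<noteq> 0"
  let ?T = "\<lambda>n. toeplitz \<beta> \<beta> (\<lambda>b. exp_series (\<nu> b powi int n) (of_int (int n) * 1)) :: real^'n^'n"
  define b where "b = fst (\<beta> i)"
  define I where "I = {m. fst (\<beta> m) = b \<and> z $ m \<noteq> 0}"
  define q where "q = Max ((\<lambda>m. snd (\<beta> m)) ` I)"
  have "i \<in> I" using zi by (simp add: I_def b_def)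
  have qmax: "snd (\<beta> m) \<le> q" if "m \<in> I" for m unfolding q_def using that by (intro Max_ge) auto
  have "q \<in> (\<lambda>m. snd (\<beta> m)) ` I" unfolding q_def using \<open>i \<in> I\<close> by (intro Max_in) auto
  then obtain t where t: "t \<in> I" "snd (\<beta> t) = q" by auto
  have tb: "\<beta> t = (b, q)" using t by (simp add: I_def prod_eq_iff)
  have bK: "b < K" using block_coords_less[OF \<beta>, of i] by (simp add: b_def)
  then have \<nu>b: "1 < \<nu> b" by (rule \<nu>)
  \<comment> \<open>The position \<open>q\<close> may exceed that of \<open>i\<close>; this only
    raises the label, so the contradiction can be sought at \<open>q\<close>.\<close>
  have lab: "label_less r p (\<nu> b) q"
    using i qmax[OF \<open>i \<in> I\<close>] by (auto simp: label_less_def b_def)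
  have "0 < s b" using block_coords_less(2)[OF \<beta>, of i] by (simp add: b_def)
  then have "(b, 0) \<in> (SIGMA b:{..<K}. {..<s b})" using bK by auto
  then obtain j where j: "\<beta> j = (b, 0)"
    using \<beta> unfolding block_coords_def bij_betw_def by (metis imageE)
  \<comment> \<open>The contribution of coordinate \<open>m\<close> to the row at position 0,
    divided by the expected growth. That row sees a coordinate with offset equal to its position, so
    in the limit only \<open>t\<close>, at position \<open>q\<close>, survives.\<close>
  define c where "c n m = (if fst (\<beta> m) = b then real n ^ snd (\<beta> m) / real n ^ q / fact (snd (\<beta> m)) * z $ m else 0)" for n m
  have row: "(\<Sum>m\<in>UNIV. c n m) = (?T n *v z) $ j / (\<nu> b ^ n * real n ^ q)" if "1 \<le> n" for n
  proof -
    have "(?T n *v z) $ j = (\<Sum>m\<in>UNIV. \<nu> b ^ n * (real n ^ q * c n m))"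
      unfolding matrix_vector_mult_def using that
      by (auto simp: toeplitz_def fps_nth_exp_series j c_def intro!: sum.cong)
    then show ?thesis
      using \<nu>b that by (simp add: sum_distrib_left[symmetric])
  qed
  have "(\<lambda>n. \<Sum>m\<in>UNIV. c n m) \<longlonglongrightarrow> (\<Sum>m\<in>UNIV. if m = t then z $ t / fact q else 0)"
  proof (intro tendsto_sum)
    fix m
    consider "m = t" | "m \<noteq> t" "m \<in> I" | "m \<notin> I" by blast
    then show "(\<lambda>n. c n m) \<longlonglongrightarrow> (if m = t then z $ t / fact q else 0)"
    proof cases
      case 1
      have "eventually (\<lambda>n. c n m = z $ t / fact q) sequentially"
        using eventually_gt_at_top[of 0] by eventually_elim (simp add: 1 c_def tb)
      then show ?thesis using 1 by (simp add: tendsto_eventually)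
    next
      case 2
      then have "snd (\<beta> m) \<noteq> q"
        using block_coords_inj[OF \<beta>, of m t] tb by (auto simp: I_def prod_eq_iff)
      then have "snd (\<beta> m) < q" using qmax[OF 2(2)] by simp
      then have "(\<lambda>n. real n ^ snd (\<beta> m) / real n ^ q * (1 / fact (snd (\<beta> m)) * z $ m)) \<longlonglongrightarrow> 0"
        by (intro tendsto_mult_left_zero power_ratio_tendsto_0)
      then show ?thesis using 2 by (simp add: c_def I_def)
    next
      case 3
      then have "c n m = 0" for n by (auto simp: c_def I_def)
      then show ?thesis using 3 t(1) by auto
    qed
  qed
  then have "(\<lambda>n. \<Sum>m\<in>UNIV. c n m) \<longlonglongrightarrow> z $ t / fact q" by simp
  then have lim: "(\<lambda>n. (?T n *v z) $ j / (\<nu> b ^ n * real n ^ q)) \<longlonglongrightarrow> z $ t / fact q"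
    by (rule Lim_transform_eventually) (use row eventually_sequentially in blast)
  have lim0: "(\<lambda>n. C * (r ^ n * real n ^ p / (\<nu> b ^ n * real n ^ q))) \<longlonglongrightarrow> 0"
    by (intro tendsto_mult_right_zero growth_ratio_tendsto_0 lab r)
  have bound: "norm ((?T n *v z) $ j / (\<nu> b ^ n * real n ^ q)) \<le> C * (r ^ n * real n ^ p / (\<nu> b ^ n * real n ^ q))"
    if "1 \<le> n" for n
  proof -
    have "\<bar>(?T n *v z) $ j\<bar> \<le> C * (r ^ n * real n ^ p)"
      using le[OF that] component_le_norm_cart[of "?T n *v z" j] by linarith
    then show ?thesis using \<nu>b that by (simp add: abs_mult divide_right_mono)
  qed
  have "(\<lambda>n. (?T n *v z) $ j / (\<nu> b ^ n * real n ^ q)) \<longlonglongrightarrow> 0"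
    by (rule Lim_null_comparison[OF _ lim0]) (use bound eventually_sequentially in blast)
  from LIMSEQ_unique[OF lim this] show False using t(1) by (simp add: I_def)
qed

section \<open>Growth labels as invariants\<close>

text \<open>In flow coordinates, the basis vectors with label at most \<open>(r, p)\<close> go to
  vectors supported on coordinates with such labels. The intertwining thus embeds one coordinate
  subspace into another, and the counts are their dimensions.\<close>

lemma card_labels_le:
  fixes \<beta> \<beta>' :: "'n::finite \<Rightarrow> nat \<times> nat"
  assumes \<beta>: "block_coords \<beta> K s" and \<nu>: "\<And>b. b < K \<Longrightarrow> 1 < \<nu> b"
    and \<beta>': "block_coords \<beta>' K' s'" and \<nu>': "\<And>b. b < K' \<Longrightarrow> 1 < \<nu>' b"
    and eq: "linearly_equivalent (jordan_toeplitz \<beta> \<nu> :: real^'n^'n) (jordan_toeplitz \<beta>' \<nu>')"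
    and A: "expanding (jordan_toeplitz \<beta> \<nu> :: real^'n^'n)"
    and B: "expanding (jordan_toeplitz \<beta>' \<nu>' :: real^'n^'n)"
    and det: "\<bar>det (jordan_toeplitz \<beta> \<nu> :: real^'n^'n)\<bar> = \<bar>det (jordan_toeplitz \<beta>' \<nu>' :: real^'n^'n)\<bar>"
  shows "card {i. \<not> label_less r p (\<nu> (fst (\<beta> i))) (snd (\<beta> i))}
    \<le> card {i. \<not> label_less r p (\<nu>' (fst (\<beta>' i))) (snd (\<beta>' i))}"
proof -
  let ?A = "jordan_toeplitz \<beta> \<nu> :: real^'n^'n" and ?B = "jordan_toeplitz \<beta>' \<nu>' :: real^'n^'n"
  let ?F = "\<lambda>k. toeplitz \<beta> \<beta> (\<lambda>b. exp_series (\<nu> b powi k) (of_int k * 1)) :: real^'n^'n"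
  let ?G = "\<lambda>k. toeplitz \<beta>' \<beta>' (\<lambda>b. exp_series (\<nu>' b powi k) (of_int k * 1)) :: real^'n^'n"
  obtain S :: "real^'n^'n" and C where S: "invertible S" "C > 0"
    and SC: "\<And>n y. norm (zpow ?B (int n) *v (S *v y)) \<le> C * norm (zpow ?A (int n) *v y)"
    using linearly_equivalent_orbits[OF eq A B det] by blast
  have \<nu>0: "\<nu> b \<noteq> 0" if "b < K" for b using \<nu>[OF that] by linarith
  have \<nu>'0: "\<nu>' b \<noteq> 0" if "b < K'" for b using \<nu>'[OF that] by linarith
  obtain P where P: "invertible P" "\<And>k. zpow ?A k ** P = P ** ?F k"
    using zpow_jordan_toeplitz[where c = 1 and \<mu> = \<nu>, OF \<beta> \<nu>0] by (metis zero_neq_one)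
  obtain Q where Q: "invertible Q" "\<And>k. zpow ?B k ** Q = Q ** ?G k"
    using zpow_jordan_toeplitz[where c = 1 and \<mu> = \<nu>', OF \<beta>' \<nu>'0] by (metis zero_neq_one)
  define S' where "S' = matrix_inv Q ** S ** P"
  have S': "invertible S'"
    unfolding S'_def by (intro invertible_mult invertible_matrix_inv P(1) Q(1) S(1))
  define C' where "C' = entry_sum (matrix_inv Q) * (C * entry_sum P)"
  have C'0: "C' \<ge> 0" using S(2) by (simp add: C'_def entry_sum_nonneg)
  have SC': "norm (?G (int n) *v (S' *v y)) \<le> C' * norm (?F (int n) *v y)" for n y
  proof -
    have "?G (int n) ** S' = matrix_inv Q ** (Q ** ?G (int n)) ** S'"
      by (simp add: matrix_mul_assoc matrix_inv_left[OF Q(1)])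
    also have "\<dots> = matrix_inv Q ** zpow ?B (int n) ** (Q ** matrix_inv Q) ** S ** P"
      unfolding Q(2)[symmetric] S'_def by (simp only: matrix_mul_assoc)
    also have "\<dots> = matrix_inv Q ** zpow ?B (int n) ** S ** P"
      by (simp add: matrix_inv_right[OF Q(1)])
    finally have "?G (int n) *v (S' *v y) = matrix_inv Q *v (zpow ?B (int n) *v (S *v (P *v y)))"
      by (simp add: matrix_vector_mul_assoc matrix_mul_assoc)
    then have "norm (?G (int n) *v (S' *v y)) \<le> entry_sum (matrix_inv Q) * norm (zpow ?B (int n) *v (S *v (P *v y)))"
      by (simp add: norm_matrix_vector_le)
    also have "\<dots> \<le> entry_sum (matrix_inv Q) * (C * norm (zpow ?A (int n) *v (P *v y)))"
      by (intro mult_left_mono SC entry_sum_nonneg)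
    also have "zpow ?A (int n) *v (P *v y) = P *v (?F (int n) *v y)"
      by (simp add: matrix_vector_mul_assoc P(2))
    also have "entry_sum (matrix_inv Q) * (C * norm (P *v (?F (int n) *v y)))
        \<le> entry_sum (matrix_inv Q) * (C * (entry_sum P * norm (?F (int n) *v y)))"
      using S(2) by (intro mult_left_mono norm_matrix_vector_le entry_sum_nonneg) auto
    finally show ?thesis by (simp add: C'_def mult_ac)
  qed
  define I where "I = {i. \<not> label_less r p (\<nu> (fst (\<beta> i))) (snd (\<beta> i))}"
  define I' where "I' = {i. \<not> label_less r p (\<nu>' (fst (\<beta>' i))) (snd (\<beta>' i))}"
  have S'0: "S' $ m $ i = 0" if "i \<in> I" "m \<notin> I'" for i m
  proof -
    have "(S' *v axis i 1) $ m = 0"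
    proof (rule growth_bound_imp_zero[where \<nu> = \<nu>', OF \<beta>' \<nu>'])
      show "0 < \<nu> (fst (\<beta> i))" using \<nu> block_coords_less(1)[OF \<beta>, of i] by force
      show "norm (?G (int n) *v (S' *v axis i 1)) \<le> (C' * real CARD('n)) * (\<nu> (fst (\<beta> i)) ^ n * real n ^ snd (\<beta> i))"
        if "1 \<le> n" for n
        using SC'[of n "axis i 1"] mult_left_mono[OF exp_flow_axis_le[where j = i and \<nu> = \<nu>, OF \<beta> \<nu> that] C'0]
        by (simp add: mult.assoc)
      show "label_less (\<nu> (fst (\<beta> i))) (snd (\<beta> i)) (\<nu>' (fst (\<beta>' m))) (snd (\<beta>' m))"
        using that by (auto simp: I_def I'_def label_less_def)
    qed
    then show ?thesis by (simp add: matrix_vector_mult_def axis_def mult_delta_right)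
  qed
  let ?V = "{x :: real^'n. \<forall>i. i \<notin> I \<longrightarrow> x $ i = 0}" and ?V' = "{x :: real^'n. \<forall>i. i \<notin> I' \<longrightarrow> x $ i = 0}"
  have "(*v) S' ` ?V \<subseteq> ?V'"
  proof clarify
    fix x :: "real^'n" and m assume x: "\<forall>i. i \<notin> I \<longrightarrow> x $ i = 0" and m: "m \<notin> I'"
    have "S' $ m $ i * x $ i = 0" for i using x S'0[OF _ m] by (cases "i \<in> I") auto
    then show "(S' *v x) $ m = 0" unfolding matrix_vector_mult_def by simp
  qed
  then have "dim ((*v) S' ` ?V) \<le> dim ?V'" by (rule dim_subset)
  moreover have "dim ((*v) S' ` ?V) = dim ?V"
    by (intro dim_image_eq inj_on_subset[OF inj_matrix_vector_mult[OF S']]) auto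
  moreover have "dim ?V = card I" "dim ?V' = card I'"
    using dim_substandard_cart[of I, where 'a = real] dim_substandard_cart[of I', where 'a = real]
    by (simp_all add: dim_vec_eq)
  ultimately show ?thesis by (simp add: I_def I'_def)
qed

lemma card_label_eq:
  fixes lam lam' :: "'n::finite \<Rightarrow> real" and pos pos' :: "'n \<Rightarrow> nat"
  assumes eq: "\<And>r p. card {i. \<not> label_less r p (lam i) (pos i)} = card {i. \<not> label_less r p (lam' i) (pos' i)}"
  shows "card {i. lam i = r \<and> pos i = p} = card {i. lam' i = r \<and> pos' i = p}"
proof -
  define X where "X = {x \<in> range lam \<union> range lam'. x < r}"
  \<comment> \<open>A threshold strictly between \<open>r\<close> and all label values below
    \<open>r\<close>: at \<open>r'\<close> the count is that of the values below \<open>r\<close>,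
    whatever the position. The entry \<open>r - 1\<close> covers the case that there are
    none.\<close>
  define r' where "r' = (Max (insert (r - 1) X) + r) / 2"
  have fin: "finite (insert (r - 1) X)" by (simp add: X_def)
  have "Max (insert (r - 1) X) < r" using fin by (subst Max_less_iff) (auto simp: X_def)
  then have r': "r' < r" and gt: "x < r'" if "x \<in> X" for x
    using Max_ge[OF fin, of x] that by (auto simp: r'_def)
  have r'r: "r' < r" using \<open>Max (insert (r - 1) X) < r\<close> by (simp add: r'_def)
  have lt: "{i. \<not> label_less r' p (lam i) (pos i)} = {i. lam i < r}"
    "{i. \<not> label_less r' p (lam' i) (pos' i)} = {i. lam' i < r}" for p
    using gt r'r by (fastforce simp: label_less_def X_def)+
  have le: "{i. \<not> label_less r p (lam i) (pos i)} = {i. lam i < r} \<union> {i. lam i = r \<and> pos i \<le> p}"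
    "{i. \<not> label_less r p (lam' i) (pos' i)} = {i. lam' i < r} \<union> {i. lam' i = r \<and> pos' i \<le> p}" for p
    by (auto simp: label_less_def)
  have cum: "card {i. lam i = r \<and> pos i \<le> p} = card {i. lam' i = r \<and> pos' i \<le> p}" for p
  proof -
    have "card {i. lam i < r} + card {i. lam i = r \<and> pos i \<le> p}
        = card {i. lam' i < r} + card {i. lam' i = r \<and> pos' i \<le> p}"
      using eq[of r p] unfolding le by (subst (asm) (1 2) card_Un_disjoint) auto
    then show ?thesis using eq[of r' 0] unfolding lt by simp
  qed
  show ?thesis
  proof (cases p)
    case 0
    then show ?thesis using cum[of 0] by simp
  next
    case (Suc p')
    have split: "card {i. l i = r \<and> k i \<le> Suc p'} = card {i. l i = r \<and> k i \<le> p'} + card {i. l i = r \<and> k i = Suc p'}"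
      for l :: "'n \<Rightarrow> real" and k :: "'n \<Rightarrow> nat"
      by (subst card_Un_disjoint[symmetric]) (auto intro!: arg_cong[of _ _ card])
    show ?thesis using cum[of p'] cum[of "Suc p'"] Suc by (simp add: split)
  qed
qed

text \<open>Each block of value \<open>r\<close> and size above \<open>p\<close> contains exactly
  one coordinate at position \<open>p\<close>.\<close>

lemma card_block_label:
  assumes \<beta>: "block_coords \<beta> (length bs) (\<lambda>b. fst (bs ! b))"
  shows "card {i. snd (bs ! fst (\<beta> i)) = r \<and> snd (\<beta> i) = p} = length (filter (\<lambda>x. snd x = r \<and> p < fst x) bs)"
proof -
  have "bij_betw (\<lambda>i. fst (\<beta> i)) {i. snd (bs ! fst (\<beta> i)) = r \<and> snd (\<beta> i) = p}
      {b. b < length bs \<and> snd (bs ! b) = r \<and> p < fst (bs ! b)}"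
    unfolding bij_betw_def
  proof
    show "inj_on (\<lambda>i. fst (\<beta> i)) {i. snd (bs ! fst (\<beta> i)) = r \<and> snd (\<beta> i) = p}"
    proof (rule inj_onI)
      fix i j
      assume "i \<in> {i. snd (bs ! fst (\<beta> i)) = r \<and> snd (\<beta> i) = p}"
        "j \<in> {i. snd (bs ! fst (\<beta> i)) = r \<and> snd (\<beta> i) = p}" "fst (\<beta> i) = fst (\<beta> j)"
      then have "\<beta> i = \<beta> j" by (simp add: prod_eq_iff)
      then show "i = j" using block_coords_inj[OF \<beta>] by simp
    qed
    show "(\<lambda>i. fst (\<beta> i)) ` {i. snd (bs ! fst (\<beta> i)) = r \<and> snd (\<beta> i) = p}
        = {b. b < length bs \<and> snd (bs ! b) = r \<and> p < fst (bs ! b)}"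
    proof (intro Set.set_eqI iffI)
      fix b assume b: "b \<in> {b. b < length bs \<and> snd (bs ! b) = r \<and> p < fst (bs ! b)}"
      then have "(b, p) \<in> (SIGMA b:{..<length bs}. {..<fst (bs ! b)})" by auto
      then obtain i where "\<beta> i = (b, p)"
        using \<beta> unfolding block_coords_def bij_betw_def by (metis imageE)
      then show "b \<in> (\<lambda>i. fst (\<beta> i)) ` {i. snd (bs ! fst (\<beta> i)) = r \<and> snd (\<beta> i) = p}"
        using b by (intro image_eqI[of b _ i]) auto
    qed (use block_coords_less[OF \<beta>] in auto)
  qed
  from bij_betw_same_card[OF this] show ?thesis by (simp add: length_filter_conv_card)
qed

section \<open>Parameters\<close>

lemma length_filter_jordan_blocks:
  assumes "length ls = length ps" "distinct ls" "i < length ls"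
  shows "length (filter (\<lambda>x. snd x = ls ! i \<and> p < fst x) (jordan_blocks ls ps))
    = length (filter (\<lambda>s. p < s) (ps ! i))"
  using assms
proof (induction ls ps arbitrary: i rule: list_induct2)
  case (Cons l ls q ps)
  show ?case
  proof (cases i)
    case 0
    have "filter (\<lambda>x. snd x = l \<and> p < fst x) (jordan_blocks ls ps) = []"
      using Cons.prems Cons.hyps by (auto simp: filter_empty_conv set_jordan_blocks)
    then show ?thesis by (simp add: 0 jordan_blocks_Cons filter_map o_def)
  next
    case (Suc j)
    then have "l \<noteq> ls ! j" using Cons.prems by auto
    then show ?thesis using Cons Suc by (simp add: jordan_blocks_Cons filter_map o_def)
  qed
qed simp

text \<open>The counts are the parts of the conjugate partition. Their successive differences are
  the multiplicities of the values \<open>Suc p\<close>, and positivity settles the value 0.\<close>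

lemma decreasing_list_eqI:
  fixes xs ys :: "nat list"
  assumes sorted: "sorted_wrt (\<ge>) xs" "sorted_wrt (\<ge>) ys"
    and pos: "\<forall>s\<in>set xs. 1 \<le> s" "\<forall>s\<in>set ys. 1 \<le> s"
    and count: "\<And>p. length (filter (\<lambda>s. p < s) xs) = length (filter (\<lambda>s. p < s) ys)"
  shows "xs = ys"
proof -
  have split: "length (filter (\<lambda>s. p < s) zs) = count (mset zs) (Suc p) + length (filter (\<lambda>s. Suc p < s) zs)"
    for p :: nat and zs
    by (induction zs) auto
  have "count (mset xs) v = count (mset ys) v" for v
  proof (cases v)
    case 0
    then show ?thesis using pos by (metis count_mset_0_iff not_one_le_zero)
  next
    case (Suc p)
    show ?thesis using split[of p xs] split[of p ys] count[of p] count[of "Suc p"] Suc by simp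
  qed
  then have "mset (rev xs) = mset (rev ys)" by (simp add: multiset_eq_iff)
  moreover have "sorted (rev xs)" "sorted (rev ys)" using sorted by (simp_all add: sorted_wrt_rev)
  ultimately have "rev xs = rev ys" by (metis properties_for_sort)
  then show ?thesis by simp
qed

lemma jordan_parametersD:
  assumes "jordan_parameters n k ns ls ps"
  shows "length ls = length ps" "distinct ls" "sorted_wrt (<) ls"
    "\<And>i. i < length ls \<Longrightarrow> partition_of (ns ! i) (ps ! i) \<and> 1 \<le> ns ! i \<and> 1 < ls ! i"
    "sum_list (map fst (jordan_blocks ls ps)) = n"
    "prod_list (map (\<lambda>x. snd x ^ fst x) (jordan_blocks ls ps)) = 2"
proof -
  have len: "length ls = length ps" "length ls = k" using assms by (auto simp: jordan_parameters_def)
  show "length ls = length ps" by fact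
  show "sorted_wrt (<) ls" using assms by (auto simp: jordan_parameters_def)
  then show "distinct ls" by (simp add: strict_sorted_iff)
  show P: "\<And>i. i < length ls \<Longrightarrow> partition_of (ns ! i) (ps ! i) \<and> 1 \<le> ns ! i \<and> 1 < ls ! i"
    using assms by (auto simp: jordan_parameters_def)
  have sum: "sum_list (ps ! i) = ns ! i" if "i < k" for i
    using P[of i] that len by (auto simp: partition_of_def)
  have "sum_list (map sum_list ps) = (\<Sum>i<k. ns ! i)"
    using sum len by (simp add: sum_list_sum_nth atLeast0LessThan)
  then show "sum_list (map fst (jordan_blocks ls ps)) = n"
    using assms len by (simp add: sum_list_jordan_blocks jordan_parameters_def)
  have "(\<Prod>i<length ls. (ls ! i) ^ sum_list (ps ! i)) = (\<Prod>i<k. (ls ! i) ^ (ns ! i))"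
    using sum len by simp
  then show "prod_list (map (\<lambda>x. snd x ^ fst x) (jordan_blocks ls ps)) = 2"
    using assms len by (simp add: prod_list_jordan_blocks jordan_parameters_def)
qed

text \<open>The counts with \<open>p = 0\<close> reveal which eigenvalues occur, and sortedness then
  fixes \<open>ls\<close>. For each eigenvalue the remaining counts form the conjugate of its
  partition.\<close>

lemma jordan_blocks_unique:
  assumes p: "jordan_parameters n k ns ls ps" "jordan_parameters n' k' ns' ls' ps'"
    and count: "\<And>r p. length (filter (\<lambda>x. snd x = r \<and> p < fst x) (jordan_blocks ls ps))
      = length (filter (\<lambda>x. snd x = r \<and> p < fst x) (jordan_blocks ls' ps'))"
  shows "ls = ls' \<and> ps = ps'"
proof -
  have set: "set ls = {r. 0 < length (filter (\<lambda>x. snd x = r \<and> 0 < fst x) (jordan_blocks ls ps))}"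
    if J: "jordan_parameters n k ns ls ps" for n k ns ls ps
  proof -
    note D = jordan_parametersD[OF J]
    have "\<exists>s. s \<in> set (ps ! i) \<and> 0 < s" if "i < length ls" for i
    proof -
      have "ps ! i \<noteq> []" using D(4)[OF that] by (auto simp: partition_of_def)
      then have "hd (ps ! i) \<in> set (ps ! i)" by simp
      moreover from this have "0 < hd (ps ! i)" using D(4)[OF that] by (force simp: partition_of_def)
      ultimately show ?thesis by blast
    qed
    then have ex: "\<exists>s. (s, ls ! i) \<in> set (jordan_blocks ls ps) \<and> 0 < s" if "i < length ls" for i
      using that unfolding set_jordan_blocks[OF D(1)] by blast
    have "\<exists>x\<in>set (jordan_blocks ls ps). snd x = r \<and> 0 < fst x" if "r \<in> set ls" for r
      using that ex by (metis fst_conv snd_conv in_set_conv_nth)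
    moreover have "snd x \<in> set ls" if "x \<in> set (jordan_blocks ls ps)" for x
      using that by (auto simp: set_jordan_blocks[OF D(1)])
    ultimately have "r \<in> set ls \<longleftrightarrow> (\<exists>x\<in>set (jordan_blocks ls ps). snd x = r \<and> 0 < fst x)" for r
      by blast
    then show ?thesis by (auto simp: filter_empty_conv)
  qed
  have "set ls = set ls'"
    unfolding set[OF p(1)] set[OF p(2)] by (simp only: count)
  then have ls: "ls = ls'"
    using jordan_parametersD(3)[OF p(1)] jordan_parametersD(3)[OF p(2)] by (metis strict_sorted_equal)
  have "ps ! i = ps' ! i" if "i < length ps" for i
  proof (rule decreasing_list_eqI)
    have i: "i < length ls" "i < length ls'" using that jordan_parametersD(1)[OF p(1)] ls by simp_all
    show "sorted_wrt (\<ge>) (ps ! i)" "\<forall>s\<in>set (ps ! i). 1 \<le> s"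
      using jordan_parametersD(4)[OF p(1) i(1)] by (auto simp: partition_of_def)
    show "sorted_wrt (\<ge>) (ps' ! i)" "\<forall>s\<in>set (ps' ! i). 1 \<le> s"
      using jordan_parametersD(4)[OF p(2) i(2)] by (auto simp: partition_of_def)
    show "length (filter (\<lambda>s. q < s) (ps ! i)) = length (filter (\<lambda>s. q < s) (ps' ! i))" for q
      using length_filter_jordan_blocks[OF jordan_parametersD(1,2)[OF p(1)] i(1), of q]
        length_filter_jordan_blocks[OF jordan_parametersD(1,2)[OF p(2)] i(2), of q] count ls by simp
  qed
  then have "ps = ps'"
    using jordan_parametersD(1)[OF p(1)] jordan_parametersD(1)[OF p(2)] ls by (simp add: list_eq_iff_nth_eq)
  then show ?thesis using ls by simp
qed

lemma jordan_dilation_eq: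
  fixes e :: "'n::finite \<Rightarrow> nat"
  assumes e: "bij_betw e UNIV {..<CARD('n)}" and n: "sum_list (map fst (jordan_blocks ls ps)) = CARD('n)"
  shows "jordan_dilation e ls ps
      = jordan_toeplitz (block_index (map fst (jordan_blocks ls ps)) \<circ> e) (\<lambda>b. snd (jordan_blocks ls ps ! b))"
    and "block_coords (block_index (map fst (jordan_blocks ls ps)) \<circ> e) (length (jordan_blocks ls ps))
      (\<lambda>b. fst (jordan_blocks ls ps ! b))"
proof -
  let ?bs = "jordan_blocks ls ps"
  show "jordan_dilation e ls ps = jordan_toeplitz (block_index (map fst ?bs) \<circ> e) (\<lambda>b. snd (?bs ! b))"
    using from_mat_jordan_matrix[OF e n] by (simp add: jordan_dilation_def from_mat_def)
  show "block_coords (block_index (map fst ?bs) \<circ> e) (length ?bs) (\<lambda>b. fst (?bs ! b))"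
    using block_coords_block_index[OF e n]
      block_coords_cong[of "length ?bs" "\<lambda>b. map fst ?bs ! b" "\<lambda>b. fst (?bs ! b)" "block_index (map fst ?bs) \<circ> e"]
    by simp
qed

lemma jordan_dilation_parameters:
  fixes e :: "'n::finite \<Rightarrow> nat"
  assumes e: "bij_betw e UNIV {..<CARD('n)}" and p: "jordan_parameters CARD('n) k ns ls ps"
  shows "b < length (jordan_blocks ls ps) \<Longrightarrow> 1 < snd (jordan_blocks ls ps ! b)"
    and "expanding (jordan_dilation e ls ps)" "det (jordan_dilation e ls ps) = 2"
proof -
  let ?bs = "jordan_blocks ls ps"
  note D = jordan_parametersD[OF p]
  note J = jordan_dilation_eq[OF e D(5)]
  have "x \<in> set ?bs \<Longrightarrow> 1 < snd x \<and> 0 < fst x" for x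
    using D(4) by (force simp: set_jordan_blocks[OF D(1)] partition_of_def)
  then have bs: "1 < snd (?bs ! b)" "0 < fst (?bs ! b)" if "b < length ?bs" for b
    using that by auto
  show "b < length ?bs \<Longrightarrow> 1 < snd (?bs ! b)" by (rule bs)
  show "expanding (jordan_dilation e ls ps)"
    unfolding J(1)
    by (rule jordan_form_expanding[OF jordan_form_real[OF J(2) bs(2)]]) (use bs(1) in fastforce)+
  show "det (jordan_dilation e ls ps) = 2"
    unfolding J(1) det_jordan_toeplitz[OF J(2)] prod_block_values[OF J(2)] by (rule D(6))
qed

section \<open>The canonical parameters of an expansive dilation\<close>

text \<open>Collecting blocks by eigenvalue and sorting the sizes only reorders them. It is applied
  after eigenvalues have been replaced by powers of their moduli, when distinct complex eigenvalues
  may have merged.\<close>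

lemma mset_jordan_blocks_grouped:
  fixes bs :: "(nat \<times> real) list"
  defines "ls \<equiv> sorted_list_of_set (snd ` set bs)"
  shows "mset (jordan_blocks ls (map (\<lambda>l. rev (sort (map fst (filter (\<lambda>x. snd x = l) bs)))) ls)) = mset bs"
proof (rule multiset_eqI)
  fix x
  define F where "F l = map (\<lambda>s. (s, l)) (rev (sort (map fst (filter (\<lambda>x. snd x = l) bs))))" for l
  have jb: "jordan_blocks ls (map (\<lambda>l. rev (sort (map fst (filter (\<lambda>x. snd x = l) bs)))) ls) = concat (map F ls)"
    by (simp add: jordan_blocks_def F_def[abs_def] map_zip_map2 zip_same_conv_map map2_map_map o_def)
  have F: "count (mset (F l)) x = (if snd x = l then count (mset bs) x else 0)" for l
  proof -
    have "mset (F l) = image_mset (\<lambda>y. (fst y, l)) (filter_mset (\<lambda>x. snd x = l) (mset bs))"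
      by (simp add: F_def image_mset.compositionality o_def mset_filter)
    also have "\<dots> = image_mset id (filter_mset (\<lambda>x. snd x = l) (mset bs))"
      by (rule image_mset_cong) (auto simp: prod_eq_iff)
    finally show ?thesis by simp
  qed
  have dist: "distinct ls" and set: "set ls = snd ` set bs" by (simp_all add: ls_def)
  have "count (mset (concat (map F ls))) x = (\<Sum>l\<leftarrow>ls. count (mset (F l)) x)"
    by (induction ls) auto
  also have "\<dots> = (\<Sum>l\<in>snd ` set bs. if snd x = l then count (mset bs) x else 0)"
    using dist by (simp add: F sum_list_distinct_conv_sum_set set)
  also have "\<dots> = count (mset bs) x"
    by (auto simp: count_mset_0_iff)
  finally show "count (mset (jordan_blocks ls (map (\<lambda>l. rev (sort (map fst (filter (\<lambda>x. snd x = l) bs)))) ls))) x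
      = count (mset bs) x" unfolding jb .
qed

text \<open>Source of the bound \<open>l < 2\<close>: the eigenvalues multiply to 2, and in
  dimension at least two some further factor exceeds 1. In dimension one the eigenvalue would be 2
  itself.\<close>

lemma less_prod_of_gt_1:
  fixes f :: "'n::finite \<Rightarrow> real"
  assumes "\<And>i. 1 < f i" "2 \<le> CARD('n)"
  shows "f i < (\<Prod>i\<in>UNIV. f i)"
proof -
  have "UNIV - {i} \<noteq> {}"
  proof
    assume "UNIV - {i} = {}"
    then have "card (UNIV :: 'n set) \<le> card {i}" by (intro card_mono) auto
    then show False using assms(2) by simp
  qed
  then have "1 < (\<Prod>j\<in>UNIV - {i}. f j)"
    by (intro less_1_prod assms) auto
  then have "f i * 1 < f i * (\<Prod>j\<in>UNIV - {i}. f j)"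
    using assms(1)[of i] by (intro mult_strict_left_mono) auto
  then show ?thesis using prod.remove[of UNIV i f] by simp
qed

lemma jordan_dilation_exists:
  fixes A :: "real^'n^'n" and e :: "'n \<Rightarrow> nat"
  assumes n2: "2 \<le> CARD('n)" and e: "bij_betw e UNIV {..<CARD('n)}" and A: "expansive_dilation A"
  shows "\<exists>k ns ls ps. jordan_parameters CARD('n) k ns ls ps \<and>
    expansive_dilation (jordan_dilation e ls ps) \<and> linearly_equivalent A (jordan_dilation e ls ps)"
proof -
  obtain bs P where bs: "sum_list (map fst bs) = CARD('n)"
    "jordan_form A (block_index (map fst bs) \<circ> e) (length bs) (\<lambda>b. fst (bs ! b)) (\<lambda>b. snd (bs ! b)) P"
    using jordan_form_exists[OF e] by blast
  define \<beta> where "\<beta> = block_index (map fst bs) \<circ> e"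
  define K where "K = length bs"
  define \<mu> where "\<mu> = (\<lambda>b. snd (bs ! b))"
  define s where "s = (\<lambda>b. fst (bs ! b))"
  have J: "jordan_form A \<beta> K s \<mu> P" using bs(2) by (simp add: \<beta>_def K_def \<mu>_def s_def)
  then have \<beta>: "block_coords \<beta> K s" and s: "\<And>b. b < K \<Longrightarrow> 0 < s b"
    by (auto simp: jordan_form_def)
  have \<mu>1: "1 < cmod (\<mu> b)" if "b < K" for b by (rule expansive_eigenvalue[OF J A that])
  have d: "1 < \<bar>det A\<bar>" using jordan_form_expanding[OF J \<mu>1] by (simp add: expanding_def)
  define t where "t = ln 2 / ln \<bar>det A\<bar>"
  have t: "t > 0" using d by (simp add: t_def)
  define \<nu> where "\<nu> b = cmod (\<mu> b) powr t" for b
  have \<nu>1: "1 < \<nu> b" if "b < K" for b using \<mu>1[OF that] t by (simp add: \<nu>_def)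
  define bs' where "bs' = map (\<lambda>x. (fst x, cmod (snd x) powr t)) bs"
  have bs'_nth: "fst (bs' ! b) = s b" "snd (bs' ! b) = \<nu> b" if "b < K" for b
    using that by (simp_all add: bs'_def s_def \<nu>_def \<mu>_def K_def)
  have len': "length bs' = K" by (simp add: bs'_def K_def)
  have fst': "map fst bs' = map fst bs" by (simp add: bs'_def)
  define ls where "ls = sorted_list_of_set (snd ` set bs')"
  define ps where "ps = map (\<lambda>l. rev (sort (map fst (filter (\<lambda>x. snd x = l) bs')))) ls"
  define jb where "jb = jordan_blocks ls ps"
  have mset: "mset jb = mset bs'"
    unfolding jb_def ps_def ls_def by (rule mset_jordan_blocks_grouped)
  have "length jb = K" using mset len' by (metis size_mset)
  \<comment> \<open>The comparison of Jordan forms expects block \<open>b\<close> of both matrices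
    to have the same size, so the sorted blocks are matched with those of \<open>A\<close>.\<close>
  obtain \<pi> where \<pi>: "\<pi> permutes {..<length jb}" "permute_list \<pi> jb = bs'"
    using mset_eq_permutation[OF mset[symmetric]] by blast
  have \<pi>_bij: "bij_betw \<pi> {..<K} {..<K}" using \<pi>(1) \<open>length jb = K\<close> by (simp add: permutes_imp_bij)
  have \<pi>_nth: "jb ! \<pi> b = bs' ! b" if "b < K" for b
    using permute_list_nth[OF \<pi>(1), of b] that \<open>length jb = K\<close> \<pi>(2) by simp
  have "sum_list (map fst jb) = sum_list (map fst bs')"
    using mset by (metis mset_map sum_mset_sum_list)
  then have n: "sum_list (map fst jb) = CARD('n)" using bs(1) fst' by simp
  note JD = jordan_dilation_eq[OF e n[unfolded jb_def], folded jb_def]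
  obtain \<gamma> where \<gamma>: "block_coords \<gamma> K (\<lambda>b. fst (jb ! \<pi> b))"
    "jordan_toeplitz \<gamma> (\<lambda>b. snd (jb ! \<pi> b)) = jordan_dilation e ls ps"
    using relabel_blocks[OF JD(2)[unfolded \<open>length jb = K\<close>] \<pi>_bij, of "\<lambda>b. snd (jb ! b)"] JD(1) by metis
  have \<gamma>s: "block_coords \<gamma> K s"
    using \<gamma>(1) block_coords_cong[of K "\<lambda>b. fst (jb ! \<pi> b)" s \<gamma>] by (simp add: \<pi>_nth bs'_nth)
  have B: "jordan_dilation e ls ps = jordan_toeplitz \<gamma> \<nu>"
    unfolding \<gamma>(2)[symmetric] by (rule toeplitz_cong[OF \<gamma>s]) (simp add: \<pi>_nth bs'_nth)
  have "linearly_equivalent A (jordan_dilation e ls ps)"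
    unfolding B using linearly_equivalent_jordan_forms[OF J \<mu>1 jordan_form_real[OF \<gamma>s s] t] by (simp add: \<nu>_def)
  moreover have "expansive_dilation (jordan_dilation e ls ps)"
    unfolding B by (rule expansive_dilation_jordan_toeplitz[OF \<gamma>s \<nu>1])
  moreover have "jordan_parameters CARD('n) (length ls) (map sum_list ps) ls ps"
  proof -
    have prodA: "(\<Prod>i\<in>UNIV. cmod (\<mu> (fst (\<beta> i)))) = \<bar>det A\<bar>" by (rule jordan_form_abs_det[OF J, symmetric])
    have "(\<Prod>i\<in>UNIV. \<nu> (fst (\<beta> i))) = \<bar>det A\<bar> powr t"
      unfolding \<nu>_def prodA[symmetric] by (simp add: prod_powr_distrib)
    also have "\<dots> = 2" using d by (simp add: powr_def t_def)
    finally have prod\<nu>: "(\<Prod>i\<in>UNIV. \<nu> (fst (\<beta> i))) = 2" .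
    have len: "length ps = length ls" by (simp add: ps_def)
    have set_ls: "set ls = snd ` set bs'" by (simp add: ls_def)
    have ls_12: "1 < l \<and> l < 2" if "l \<in> set ls" for l
    proof -
      obtain x where "x \<in> set bs'" "l = snd x" using \<open>l \<in> set ls\<close> set_ls by auto
      then obtain b where b: "b < K" "l = \<nu> b"
        using len' bs'_nth(2) by (metis in_set_conv_nth)
      \<comment> \<open>A nonempty block has a coordinate at position 0, so \<open>\<nu> b\<close>
        really occurs as a factor of the product 2.\<close>
      then have "(b, 0) \<in> (SIGMA b:{..<K}. {..<s b})" using s by auto
      then obtain i where "\<beta> i = (b, 0)"
        using \<beta> unfolding block_coords_def bij_betw_def by (metis imageE)
      then show ?thesis
        using less_prod_of_gt_1[of "\<lambda>i. \<nu> (fst (\<beta> i))" i, OF \<nu>1[OF block_coords_less(1)[OF \<beta>]] n2]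
          \<nu>1[OF b(1)] prod\<nu> b(2) by simp
    qed
    have ps_i: "ps ! i = rev (sort (map fst (filter (\<lambda>x. snd x = ls ! i) bs')))" if "i < length ls" for i
      using that by (simp add: ps_def)
    have pos: "1 \<le> q" if "q \<in> set (ps ! i)" "i < length ls" for q i
      using that s len' bs'_nth by (force simp: ps_i in_set_conv_nth Suc_le_eq)
    have part: "partition_of (sum_list (ps ! i)) (ps ! i)" if "i < length ls" for i
      unfolding partition_of_def using pos[OF _ that] by (auto simp: ps_i[OF that] sorted_wrt_rev)
    have one: "1 \<le> sum_list (ps ! i)" if i: "i < length ls" for i
    proof -
      have "ls ! i \<in> snd ` set bs'" using i set_ls by (metis nth_mem)
      then obtain x where "x \<in> set bs'" "snd x = ls ! i" by auto
      then have x: "fst x \<in> set (ps ! i)" by (auto simp: ps_i[OF i])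
      show ?thesis using pos[OF x i] member_le_sum_list[OF x] by linarith
    qed
    have sum: "(\<Sum>i<length ls. sum_list (ps ! i)) = CARD('n)"
      using n sum_list_jordan_blocks[of ls ps] len
      by (simp add: jb_def sum_list_sum_nth atLeast0LessThan)
    have "length ls = (\<Sum>i<length ls. 1)" by simp
    also have "\<dots> \<le> (\<Sum>i<length ls. sum_list (ps ! i))" by (intro sum_mono one) simp
    finally have kn: "length ls \<le> CARD('n)" using sum by simp
    have \<beta>': "block_coords \<beta> (length bs') (\<lambda>b. fst (bs' ! b))"
      using \<beta> block_coords_cong[of K s "\<lambda>b. fst (bs' ! b)" \<beta>] by (simp add: bs'_nth len')
    have "(\<Prod>i<length ls. (ls ! i) ^ sum_list (ps ! i)) = prod_list (map (\<lambda>x. snd x ^ fst x) jb)"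
      using len by (simp add: jb_def prod_list_jordan_blocks)
    also have "\<dots> = prod_list (map (\<lambda>x. snd x ^ fst x) bs')"
      by (simp add: mset flip: prod_mset_prod_list)
    also have "\<dots> = (\<Prod>i\<in>UNIV. snd (bs' ! fst (\<beta> i)))"
      by (rule prod_block_values[OF \<beta>', symmetric])
    also have "\<dots> = 2" using prod\<nu> bs'_nth(2)[OF block_coords_less(1)[OF \<beta>]] by simp
    finally have prod: "(\<Prod>i<length ls. (ls ! i) ^ sum_list (ps ! i)) = 2" .
    show ?thesis
      unfolding jordan_parameters_def using kn len one sum ls_12 prod part
      by (simp add: strict_sorted_list_of_set ls_def[symmetric]) (simp add: ls_def)
  qed
  ultimately show ?thesis by blast
qed

lemma jordan_dilation_unique:
  fixes e :: "'n::finite \<Rightarrow> nat"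
  assumes e: "bij_betw e UNIV {..<CARD('n)}"
    and p: "jordan_parameters CARD('n) k ns ls ps" and p': "jordan_parameters CARD('n) k' ns' ls' ps'"
    and eq: "linearly_equivalent (jordan_dilation e ls ps) (jordan_dilation e ls' ps')"
  shows "ls = ls' \<and> ps = ps'"
proof -
  let ?bs = "jordan_blocks ls ps" and ?bs' = "jordan_blocks ls' ps'"
  let ?\<beta> = "block_index (map fst ?bs) \<circ> e" and ?\<beta>' = "block_index (map fst ?bs') \<circ> e"
  note J = jordan_dilation_eq[OF e jordan_parametersD(5)[OF p]]
  note J' = jordan_dilation_eq[OF e jordan_parametersD(5)[OF p']]
  note D = jordan_dilation_parameters[OF e p] and D' = jordan_dilation_parameters[OF e p']
  have le: "card {i. \<not> label_less r q (snd (?bs ! fst (?\<beta> i))) (snd (?\<beta> i))}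
      \<le> card {i. \<not> label_less r q (snd (?bs' ! fst (?\<beta>' i))) (snd (?\<beta>' i))}" for r q
    using eq D(2) D'(2) D(3) D'(3) unfolding J(1) J'(1)
    by (intro card_labels_le[OF J(2) D(1) J'(2) D'(1)]) auto
  have ge: "card {i. \<not> label_less r q (snd (?bs' ! fst (?\<beta>' i))) (snd (?\<beta>' i))}
      \<le> card {i. \<not> label_less r q (snd (?bs ! fst (?\<beta> i))) (snd (?\<beta> i))}" for r q
    using linearly_equivalent_sym[OF eq] D(2) D'(2) D(3) D'(3) unfolding J(1) J'(1)
    by (intro card_labels_le[OF J'(2) D'(1) J(2) D(1)]) auto
  have "length (filter (\<lambda>x. snd x = r \<and> q < fst x) ?bs) = length (filter (\<lambda>x. snd x = r \<and> q < fst x) ?bs')" for r q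
    unfolding card_block_label[OF J(2), symmetric] card_block_label[OF J'(2), symmetric]
    by (rule card_label_eq) (rule antisym[OF le ge])
  then show ?thesis by (rule jordan_blocks_unique[OF p p'])
qed

theorem corollary4p3:
  fixes e :: "'n::finite \<Rightarrow> nat"
  assumes "2 \<le> CARD('n)"
    and "bij_betw e UNIV {..<CARD('n)}"
  shows
    "(\<forall>A :: real^'n^'n. expansive_dilation A \<longrightarrow>
        (\<exists>k ns ls ps. jordan_parameters CARD('n) k ns ls ps \<and>
           expansive_dilation (jordan_dilation e ls ps) \<and>
           linearly_equivalent A (jordan_dilation e ls ps))) \<and>
     (\<forall>k ns ls ps k' ns' ls' ps'.
        jordan_parameters CARD('n) k ns ls ps \<longrightarrow>
        jordan_parameters CARD('n) k' ns' ls' ps' \<longrightarrow>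
        (ls, ps) \<noteq> (ls', ps') \<longrightarrow>
        \<not> linearly_equivalent (jordan_dilation e ls ps) (jordan_dilation e ls' ps'))"
  using jordan_dilation_exists[OF assms] jordan_dilation_unique[OF assms(2)] by blast

end
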